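(* Let $d\ge 2$ and $n\ge 1$ be integers and let $|\psi\rangle_{ABS}\in\mathbb{C}^d\otimes\mathbb{C}^d\otimes\mathbb{C}^n$ be a normalized pure tripartite state. Then $$A_G(|\psi\rangle_{ABS})=G_a(|\psi\rangle_{ABS}),$$ where $A_G$ is the assisted G-concurrence and $G_a$ is the G-concurrence of assistance.
   Context: G-concurrence: for a (possibly sub-normalized) vector $|\phi\rangle=\sum_{i,j=1}^d a_{ij}|i\rangle|j\rangle\in\mathbb{C}^d\otimes\mathbb{C}^d$ with coefficient matrix $A=(a_{ij})$, $G(|\phi\rangle)=d\,[\mathrm{Det}(A^\dagger A)]^{1/d}$. For a density operator $\rho$ on $\mathbb{C}^d\otimes\mathbb{C}^d$, $G(\rho)=\min\sum_i p_iG(|\psi_i\rangle)$ over all finite decompositions $\rho=\sum_i p_i|\psi_i\rangle\langle\psi_i|$ into normalized pure states with probabilities $p_i$. G-concurrence of assistance of a normalized pure state $|\psi\rangle_{ABS}\in\mathbb{C}^d\otimes\mathbb{C}^d\otimes\mathbb{C}^n$: with $\rho_{AB}=\mathrm{Tr}_S|\psi\rangle\langle\psi|$, $G_a(|\psi\rangle_{ABS})=\max\sum_i p_i\,G(|\phi_i\rangle_{AB})$ over all finite decompositions $\rho_{AB}=\sum_i p_i|\phi_i\rangle\langle\phi_i|$ into normalized pure states with probabilities $p_i$. Local operation: a finite family of maps $\varepsilon_k(\rho)=\sum_j \hat M_{k,j}\rho\hat M_{k,j}^\dagger$, with Kraus operators acting on one party's space only (any Kraus operators of $A$ or $B$ map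 $\mathbb{C}^d$ to $\mathbb{C}^d$; those of $S$ map $\mathbb{C}^n$ to $\mathbb{C}^n$), and $\sum_{k,j}\hat M_{k,j}^\dagger\hat M_{k,j}= I$; outcome $k$ occurs with probability $p_k=\mathrm{Tr}\,\varepsilon_k(\rho)$ and leaves the state $\varepsilon_k(\rho)/p_k$. A tripartite LOCC protocol is a finite sequence of local operations by $A$, $B$, $S$, in which the choice of each operation (and of the acting party) may depend on all previous outcomes; applied to $\rho_{ABS}$ it produces an ensemble $\{q_j,\sigma^j_{ABS}\}$ of tripartite states. Assisted G-concurrence: $A_G(\rho_{ABS})=\max\sum_j q_j\,G(\sigma^j_{AB})$ with $\sigma^j_{AB}=\mathrm{Tr}_S\,\sigma^j_{ABS}$, the maximum (understood as a supremum) being over all ensembles $\{q_j,\sigma^j_{ABS}\}$ obtainable from $\rho_{ABS}$ by a tripartite LOCC protocol. For a pure state, $A_G(|\psi\rangle)=A_G(|\psi\rangle\langle\psi|)$. *)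

theory Defs
  imports "HOL-Analysis.Analysis"
begin

text \<open>Vectors of \<open>\<complex>\<^sup>d \<otimes> \<complex>\<^sup>d\<close> and \<open>\<complex>\<^sup>d \<otimes> \<complex>\<^sup>d \<otimes> \<complex>\<^sup>n\<close> are given by their coordinates in the product
  basis, indexed by \<open>'d \<times> 'd\<close> and \<open>'d \<times> 'd \<times> 'n\<close> (parties in the order A, B, S), with
  \<open>d = CARD('d)\<close> and \<open>n = CARD('n)\<close>. Operators are square matrices over the same index types.\<close>

type_synonym 'i op = "complex ^ 'i ^ 'i"

definition adj :: "complex ^ 'i ^ 'j \<Rightarrow> complex ^ 'j ^ 'i" where
  "adj A = (\<chi> i j. cnj (A $ j $ i))"

definition kron :: "('i::finite) op \<Rightarrow> ('j::finite) op \<Rightarrow> ('i \<times> 'j) op" (infixr "\<otimes>\<^sub>K" 70) where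
  "A \<otimes>\<^sub>K B = (\<chi> x y. A $ fst x $ fst y * B $ snd x $ snd y)"

text \<open>\<open>ket_bra \<phi>\<close> is \<open>|\<phi>\<rangle>\<langle>\<phi>|\<close>.\<close>

definition ket_bra :: "complex ^ 'i \<Rightarrow> 'i op" where
  "ket_bra \<phi> = (\<chi> x y. \<phi> $ x * cnj (\<phi> $ y))"

definition ptrace_S :: "('d::finite \<times> 'd \<times> 'n::finite) op \<Rightarrow> ('d \<times> 'd) op" where
  "ptrace_S \<rho> = (\<chi> x y. \<Sum>s\<in>UNIV. \<rho> $ (fst x, snd x, s) $ (fst y, snd y, s))"

definition coeff_matrix :: "complex ^ ('d::finite \<times> 'd) \<Rightarrow> complex ^ 'd ^ 'd" where
  "coeff_matrix \<phi> = (\<chi> i j. \<phi> $ (i, j))"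

text \<open>The determinant below is a nonnegative real number, so \<open>Re\<close> only changes its type.\<close>

definition G_pure :: "complex ^ ('d::finite \<times> 'd) \<Rightarrow> real" where
  "G_pure \<phi> = real CARD('d) *
     root CARD('d) (Re (det (adj (coeff_matrix \<phi>) ** coeff_matrix \<phi>)))"

definition is_decomposition :: "('i::finite) op \<Rightarrow> (real \<times> (complex ^ 'i)) list \<Rightarrow> bool" where
  "is_decomposition \<rho> D \<longleftrightarrow>
     (\<forall>(p, \<phi>) \<in> set D. p \<ge> 0 \<and> norm \<phi> = 1) \<and>
     (\<Sum>(p, \<phi>)\<leftarrow>D. p) = 1 \<and>
     \<rho> = (\<Sum>(p, \<phi>)\<leftarrow>D. p *\<^sub>R ket_bra \<phi>)"

definition avg_G :: "(real \<times> (complex ^ ('d::finite \<times> 'd))) list \<Rightarrow> real" where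
  "avg_G D = (\<Sum>(p, \<phi>)\<leftarrow>D. p * G_pure \<phi>)"

text \<open>\<open>LEAST\<close> and \<open>GREATEST\<close> (on \<open>real\<close>) are a genuine minimum and maximum, not \<open>Inf\<close> and \<open>Sup\<close>:
  they are meaningful only because the extrema over decompositions are attained.\<close>

definition G_conc :: "('d::finite \<times> 'd) op \<Rightarrow> real" where
  "G_conc \<rho> = (LEAST x. \<exists>D. is_decomposition \<rho> D \<and> x = avg_G D)"

definition G_of_assistance :: "complex ^ ('d::finite \<times> 'd \<times> 'n::finite) \<Rightarrow> real" where
  "G_of_assistance \<psi> =
     (GREATEST x. \<exists>D. is_decomposition (ptrace_S (ket_bra \<psi>)) D \<and> x = avg_G D)"

text \<open>A local operation is a list over the outcomes \<open>k\<close>, whose entries are the lists of Kraus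
  operators \<open>M\<^sub>k\<^sub>,\<^sub>j\<close> of the maps \<open>\<epsilon>\<^sub>k\<close>.\<close>

definition kraus_complete :: "('i::finite) op list list \<Rightarrow> bool" where
  "kraus_complete F \<longleftrightarrow> (\<Sum>M\<leftarrow>concat F. adj M ** M) = mat 1"

definition on_A :: "('d::finite) op \<Rightarrow> ('d \<times> 'd \<times> 'n::finite) op" where
  "on_A M = M \<otimes>\<^sub>K mat 1 \<otimes>\<^sub>K mat 1"

definition on_B :: "('d::finite) op \<Rightarrow> ('d \<times> 'd \<times> 'n::finite) op" where
  "on_B M = mat 1 \<otimes>\<^sub>K M \<otimes>\<^sub>K mat 1"

definition on_S :: "('n::finite) op \<Rightarrow> ('d::finite \<times> 'd \<times> 'n) op" where
  "on_S M = mat 1 \<otimes>\<^sub>K mat 1 \<otimes>\<^sub>K M"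

definition local_operation :: "('d::finite \<times> 'd \<times> 'n::finite) op list list \<Rightarrow> bool" where
  "local_operation F \<longleftrightarrow>
     (\<exists>Ms. kraus_complete Ms \<and> F = map (map on_A) Ms) \<or>
     (\<exists>Ms. kraus_complete Ms \<and> F = map (map on_B) Ms) \<or>
     (\<exists>Ms. kraus_complete Ms \<and> F = map (map on_S) Ms)"

definition kraus_map :: "('i::finite) op list \<Rightarrow> 'i op \<Rightarrow> 'i op" where
  "kraus_map Ms \<rho> = (\<Sum>M\<leftarrow>Ms. M ** \<rho> ** adj M)"

definition outcome_prob :: "('i::finite) op list \<Rightarrow> 'i op \<Rightarrow> real" where
  "outcome_prob Ms \<rho> = Re (trace (kraus_map Ms \<rho>))"

definition post_state :: "('i::finite) op list \<Rightarrow> 'i op \<Rightarrow> 'i op" where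
  "post_state Ms \<rho> = (1 / outcome_prob Ms \<rho>) *\<^sub>R kraus_map Ms \<rho>"

text \<open>\<open>locc_ensemble \<rho> E\<close>: some tripartite LOCC protocol applied to \<open>\<rho>\<close> produces the ensemble \<open>E\<close>.
  In \<open>round\<close>, \<open>E k\<close> is the ensemble produced by the remainder of the protocol after outcome \<open>k\<close>,
  which may be any protocol depending on \<open>k\<close>; outcomes of probability zero do not occur and are
  dropped.\<close>

inductive locc_ensemble ::
  "('d::finite \<times> 'd \<times> 'n::finite) op \<Rightarrow> (real \<times> ('d \<times> 'd \<times> 'n) op) list \<Rightarrow> bool" where
  stop: "locc_ensemble \<rho> [(1, \<rho>)]"
| round: "locc_ensemble \<rho>
      (concat (map (\<lambda>k. map (\<lambda>(q, \<sigma>). (outcome_prob (F ! k) \<rho> * q, \<sigma>)) (E k))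
         (filter (\<lambda>k. outcome_prob (F ! k) \<rho> > 0) [0..<length F])))"
  if "local_operation F"
     "\<And>k. k < length F \<Longrightarrow> outcome_prob (F ! k) \<rho> > 0 \<Longrightarrow>
            locc_ensemble (post_state (F ! k) \<rho>) (E k)"

definition assisted_G :: "('d::finite \<times> 'd \<times> 'n::finite) op \<Rightarrow> real" where
  "assisted_G \<rho> = Sup {\<Sum>(q, \<sigma>)\<leftarrow>E. q * G_conc (ptrace_S \<sigma>) | E. locc_ensemble \<rho> E}"

end

(*  Write psi as an amplitude matrix Y, so that rho_AB = Y Y^H. For a positive operator tau let
    H(tau) be the supremum of sum G(x) over all unnormalised decompositions
    tau = sum |x><x|; G is homogeneous of degree two, so H(rho_AB) = G_a(psi).

    Upper bound: refine every outcome of a protocol to its individual Kraus operators. An operation of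
    S only splits a decomposition of rho_AB, and H is superadditive. For an operator M of A or B,
    G(M x) = |det M|^(2/d) G(x), and every decomposition of M tau M^H arises from one of tau, whence
    H(M tau M^H) <= |det M|^(2/d) H(tau). Hadamard's inequality and AM-GM give
    |det M|^(2/d) <= tr(M^H M)/d, so the factors add up to at most 1 over a complete set of Kraus
    operators. As G is a convex roof, undoing the refinement at the end can only lower the average.

    Lower bound: a measurement on S alone steers A and B to any decomposition of rho_AB. *)

theory Submission
  imports Defs
begin

section \<open>Complex inner product and mixtures\<close>

text \<open>Antilinear in the first argument. The real inner product is only its real part
  (\<open>inner_eq_Re_cip\<close>), and its vanishing does not give complex orthogonality.\<close>

definition cip :: "complex ^ 'i \<Rightarrow> complex ^ 'i \<Rightarrow> complex" where
  "cip u v = (\<Sum>i\<in>UNIV. cnj (u $ i) * v $ i)"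

lemma cip_add_right: "cip u (v + w) = cip u v + cip u w"
  by (simp add: cip_def algebra_simps sum.distrib)

lemma cip_diff_right: "cip u (v - w) = cip u v - cip u w"
  by (simp add: cip_def algebra_simps sum_subtractf)

lemma cip_scale_right: "cip u (c *s v) = c * cip u v"
  by (simp add: cip_def algebra_simps sum_distrib_left)

lemma cip_zero_right [simp]: "cip u 0 = 0"
  by (simp add: cip_def)

lemma cip_commute: "cip v u = cnj (cip u v)"
  by (simp add: cip_def mult.commute)

lemma cip_add_left: "cip (u + v) w = cip u w + cip v w"
  by (simp add: cip_def algebra_simps sum.distrib)

lemma cip_diff_left: "cip (u - v) w = cip u w - cip v w"
  by (simp add: cip_def algebra_simps sum_subtractf)

lemma cip_scale_left: "cip (c *s u) v = cnj c * cip u v"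
  by (simp add: cip_def algebra_simps sum_distrib_left)

lemma cip_zero_left [simp]: "cip 0 u = 0"
  by (simp add: cip_def)

lemma cip_self: "cip (u :: complex ^ 'i::finite) u = of_real ((norm u)\<^sup>2)"
proof -
  have "(norm u)\<^sup>2 = (\<Sum>i\<in>UNIV. (norm (u $ i))\<^sup>2)"
    by (simp add: power2_norm_eq_inner inner_vec_def)
  then have "complex_of_real ((norm u)\<^sup>2) = (\<Sum>i\<in>UNIV. u $ i * cnj (u $ i))"
    by (simp only: of_real_sum complex_norm_square)
  then show ?thesis by (simp only: cip_def mult.commute)
qed

lemma cip_self_eq_0: "cip (u :: complex ^ 'i::finite) u = 0 \<longleftrightarrow> u = 0"
  by (simp add: cip_self)

lemma inner_eq_Re_cip: "(u :: complex ^ 'i::finite) \<bullet> v = Re (cip u v)"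
  by (simp add: inner_vec_def cip_def inner_complex_def)

lemma cip_matrix_right:
  "cip u (A *v v) = cip (adj A *v u) (v :: complex ^ 'j::finite)"
  for u :: "complex ^ 'i::finite"
proof -
  have "cip u (A *v v) = (\<Sum>i\<in>UNIV. \<Sum>j\<in>UNIV. cnj (u $ i) * A $ i $ j * v $ j)"
    by (simp add: cip_def matrix_vector_mult_def sum_distrib_left mult.assoc)
  also have "\<dots> = (\<Sum>j\<in>UNIV. \<Sum>i\<in>UNIV. cnj (u $ i) * A $ i $ j * v $ j)"
    by (rule sum.swap)
  also have "\<dots> = cip (adj A *v u) v"
    by (simp add: cip_def matrix_vector_mult_def adj_def sum_distrib_left sum_distrib_right ac_simps)
  finally show ?thesis .
qed

section \<open>Adjoints, rank-one operators and traces\<close>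

lemma adj_adj [simp]: "adj (adj A) = A"
  by (simp add: adj_def vec_eq_iff)

lemma adj_mult: "adj (A ** B) = adj B ** adj (A :: complex ^ 'n::finite ^ 'm)"
  by (simp add: adj_def matrix_matrix_mult_def vec_eq_iff mult.commute)

lemma adj_add: "adj (A + B) = adj A + adj B"
  by (simp add: adj_def vec_eq_iff)

lemma adj_diff: "adj (A - B) = adj A - adj B"
  by (simp add: adj_def vec_eq_iff)

lemma adj_zero [simp]: "adj 0 = 0"
  by (simp add: adj_def vec_eq_iff)

lemma adj_mat_1 [simp]: "adj (mat 1) = mat 1"
  by (simp add: adj_def mat_def vec_eq_iff)

lemma ket_bra_vector: "ket_bra x *v b = cip x b *s (x :: complex ^ 'i::finite)"
  by (simp add: ket_bra_def matrix_vector_mult_def cip_def vec_eq_iff sum_distrib_left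
      sum_distrib_right ac_simps)

lemma adj_ket_bra [simp]: "adj (ket_bra x) = ket_bra x"
  by (simp add: adj_def ket_bra_def vec_eq_iff mult.commute)

lemma ket_bra_scaleR: "ket_bra (c *\<^sub>R x) = c\<^sup>2 *\<^sub>R ket_bra x"
  by (simp add: ket_bra_def vec_eq_iff power2_eq_square)

lemma ket_bra_mult: "ket_bra (L *v x) = L ** ket_bra x ** adj (L :: complex ^ 'n::finite ^ 'm)"
proof -
  have "(L ** ket_bra x) $ a $ k = (L *v x) $ a * cnj (x $ k)" for a k
    by (simp add: ket_bra_def matrix_vector_mult_def matrix_matrix_mult_def sum_distrib_right
        mult.assoc)
  then have "(L ** ket_bra x ** adj L) $ a $ b = (L *v x) $ a * cnj ((L *v x) $ b)" for a b
    unfolding matrix_matrix_mult_def[of "L ** ket_bra x"]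
    by (simp add: adj_def matrix_vector_mult_def[of L] sum_distrib_left ac_simps)
  then show ?thesis by (simp add: vec_eq_iff ket_bra_def)
qed

lemma trace_ket_bra: "trace (ket_bra x) = of_real ((norm (x :: complex ^ 'i::finite))\<^sup>2)"
  unfolding cip_self[symmetric] by (simp add: trace_def ket_bra_def cip_def mult.commute)

lemma trace_scaleR: "trace (c *\<^sub>R A) = c *\<^sub>R trace (A :: complex ^ 'n::finite ^ 'n)"
  by (simp add: trace_def scaleR_sum_right)

lemma trace_adj_mult_self:
  "trace (adj M ** M) = of_real ((norm (M :: complex ^ 'n::finite ^ 'n))\<^sup>2)"
proof -
  have "(norm M)\<^sup>2 = (\<Sum>i\<in>UNIV. \<Sum>j\<in>UNIV. (norm (M $ i $ j))\<^sup>2)"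
    by (simp add: power2_norm_eq_inner inner_vec_def)
  also have "\<dots> = (\<Sum>j\<in>UNIV. \<Sum>i\<in>UNIV. (norm (M $ i $ j))\<^sup>2)"
    by (rule sum.swap)
  finally have norm: "(norm M)\<^sup>2 = (\<Sum>j\<in>UNIV. \<Sum>i\<in>UNIV. (norm (M $ i $ j))\<^sup>2)" .
  show ?thesis
    unfolding norm of_real_sum
    by (simp only: trace_def adj_def matrix_matrix_mult_def complex_norm_square)
      (simp add: mult.commute)
qed

text \<open>Weights are absorbed into lengths: squared norms play the role of probabilities, so
  applying an operator to a decomposition needs no renormalisation.\<close>

definition mixture :: "(complex ^ 'i::finite) list \<Rightarrow> 'i op" where
  "mixture xs = (\<Sum>x\<leftarrow>xs. ket_bra x)"

lemma mixture_simps [simp]: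
  "mixture [] = 0"
  "mixture (x # xs) = ket_bra x + mixture xs"
  "mixture (xs @ ys) = mixture xs + mixture ys"
  by (simp_all add: mixture_def)

lemma matrix_add_rdistrib: "(A + B) ** C = A ** C + B ** C"
  by (simp add: vec_eq_iff matrix_matrix_mult_def distrib_right sum.distrib)

lemma mixture_map_mult: "mixture (map ((*v) L) xs) = L ** mixture xs ** adj L"
  by (induction xs)
    (simp_all add: ket_bra_mult matrix_add_ldistrib matrix_add_rdistrib)

lemma trace_mixture: "trace (mixture xs) = of_real (\<Sum>x\<leftarrow>xs. (norm x)\<^sup>2)"
  by (induction xs) (simp_all add: trace_add trace_ket_bra, simp add: trace_def)

lemma adj_mixture [simp]: "adj (mixture xs) = mixture xs"
  by (induction xs) (simp_all add: adj_add)

lemma cip_mixture: "cip b (mixture xs *v b) = of_real (\<Sum>x\<leftarrow>xs. (norm (cip x b))\<^sup>2)"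
proof (induction xs)
  case (Cons x xs)
  have "cip b (cip x b *s x) = of_real ((norm (cip x b))\<^sup>2)"
    using complex_norm_square[of "cip x b"] by (simp add: cip_scale_right cip_commute[of b x])
  with Cons show ?case
    by (simp add: matrix_vector_mult_add_rdistrib cip_add_right ket_bra_vector)
qed simp

text \<open>The quadratic form is a sum of squared overlaps, so it vanishes only if each overlap
  does. Hence the vectors of a decomposition are orthogonal to the kernel of the operator.\<close>

lemma mixture_kernel:
  assumes "cip b (mixture xs *v b) = 0" "x \<in> set xs"
  shows "cip x b = 0"
proof -
  have "(\<Sum>x\<leftarrow>xs. (norm (cip x b))\<^sup>2) = 0"
    using assms(1) unfolding cip_mixture of_real_eq_0_iff .
  then have "\<forall>y\<in>set (map (\<lambda>x. (norm (cip x b))\<^sup>2) xs). y = 0"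
    by (subst sum_list_nonneg_eq_0_iff[symmetric]) auto
  then show ?thesis using assms(2) by auto
qed

lemma scaleR_eq_smult: "c *\<^sub>R u = complex_of_real c *s u"
  by (simp add: vec_eq_iff scaleR_conv_of_real[where 'a = complex])

text \<open>Reduces to the real orthogonal decomposition: as \<open>S\<close> is closed under
  multiplication by \<open>\<i>\<close>, testing against \<open>w\<close> and
  \<open>\<i> *s w\<close> kills both the real and the imaginary part of
  \<open>cip w z\<close>.\<close>

lemma complex_projection:
  fixes S :: "(complex ^ 'i::finite) set"
  assumes S: "\<And>u v. u \<in> S \<Longrightarrow> v \<in> S \<Longrightarrow> u + v \<in> S" "\<And>c u. u \<in> S \<Longrightarrow> c *s u \<in> S" "0 \<in> S"
  obtains y z where "x = y + z" "y \<in> S" "\<And>w. w \<in> S \<Longrightarrow> cip w z = 0"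
proof -
  have "subspace S"
    unfolding subspace_def using S by (auto simp: scaleR_eq_smult)
  then have span: "span S = S" by simp
  obtain y z where yz: "y \<in> span S" "\<And>w. w \<in> span S \<Longrightarrow> orthogonal z w" "x = y + z"
    by (rule orthogonal_subspace_decomp_exists[of S x]) blast
  have "cip w z = 0" if "w \<in> S" for w
  proof -
    have "Re (cip w z) = 0"
      using yz(2)[of w] that span
      by (simp add: orthogonal_def inner_eq_Re_cip[symmetric] inner_commute)
    moreover have "Re (cip (\<i> *s w) z) = 0"
      using yz(2)[of "\<i> *s w"] S(2)[OF that] span
      by (simp add: orthogonal_def inner_eq_Re_cip[symmetric] inner_commute)
    ultimately show ?thesis by (simp add: cip_scale_left complex_eq_iff)
  qed
  with yz span that show ?thesis by auto
qed

text \<open>The lists \<open>xs\<close> and the columns of \<open>Y\<close> mix to the same operator, so they differ by an isometry;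
  \<open>m x\<close> are its rows, chosen orthogonal to the kernel of \<open>Y\<close>, and \<open>P\<close> projects onto that kernel.\<close>

lemma mixture_freedom:
  fixes Y :: "complex ^ 'n::finite ^ 'i::finite"
  assumes mix: "mixture xs = Y ** adj Y"
  obtains m P where "\<And>x. x \<in> set xs \<Longrightarrow> Y *v m x = x" "mixture (map m xs) + P = mat 1"
    "Y ** P = 0" "adj P = P" "P ** P = P"
proof -
  have "\<exists>m. Y *v m = x \<and> (\<forall>k. Y *v k = 0 \<longrightarrow> cip k m = 0)" if x: "x \<in> set xs" for x
  proof -
    \<comment> \<open>The part \<open>b\<close> of \<open>x\<close> orthogonal to the range of
      \<open>Y\<close> is killed by \<open>Y ** adj Y\<close>, so by \<open>mixture_kernel\<close>
      it is orthogonal to \<open>x\<close> and must vanish.\<close>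
    obtain a b where ab: "x = a + b" "a \<in> range ((*v) Y)"
      and b: "\<And>w. w \<in> range ((*v) Y) \<Longrightarrow> cip w b = 0"
    proof (rule complex_projection[of "range ((*v) Y)" x])
      show "u + v \<in> range ((*v) Y)" if "u \<in> range ((*v) Y)" "v \<in> range ((*v) Y)" for u v
        using that by (auto simp: matrix_vector_right_distrib[symmetric])
      show "c *s u \<in> range ((*v) Y)" if "u \<in> range ((*v) Y)" for c u
        using that by (auto simp: vector_scalar_commute[symmetric])
      show "0 \<in> range ((*v) Y)" by (metis matrix_vector_mult_0_right rangeI)
    qed blast
    have "cip (adj Y *v b) (adj Y *v b) = cip b (Y *v (adj Y *v b))"
      by (simp add: cip_matrix_right)
    also have "\<dots> = cnj (cip (Y *v (adj Y *v b)) b)" by (rule cip_commute)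
    also have "\<dots> = 0" using b by simp
    finally have "adj Y *v b = 0" by (simp add: cip_self_eq_0)
    then have "cip b (mixture xs *v b) = 0"
      by (simp add: mix matrix_vector_mul_assoc[symmetric])
    then have "cip x b = 0" using mixture_kernel x by blast
    moreover have "cip a b = 0" using ab b by simp
    ultimately have "cip b b = 0" using ab(1) by (simp add: cip_add_left)
    then have "x \<in> range ((*v) Y)" using ab by (simp add: cip_self_eq_0)
    then obtain v where v: "x = Y *v v" by blast
    \<comment> \<open>Removing the kernel component from a preimage of \<open>x\<close> is what
      makes \<open>Q\<close> vanish on the kernel of \<open>Y\<close>.\<close>
    obtain k m where km: "v = k + m" "k \<in> {k. Y *v k = 0}"
      and m: "\<And>w. w \<in> {k. Y *v k = 0} \<Longrightarrow> cip w m = 0"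
      by (rule complex_projection[of "{k. Y *v k = 0}" v])
        (auto simp: matrix_vector_right_distrib vector_scalar_commute)
    then have "Y *v m = x" by (simp add: v matrix_vector_right_distrib)
    with m show ?thesis by blast
  qed
  then obtain m where m: "\<And>x. x \<in> set xs \<Longrightarrow> Y *v m x = x"
    and mker: "\<And>x k. x \<in> set xs \<Longrightarrow> Y *v k = 0 \<Longrightarrow> cip k (m x) = 0"
    by metis
  define Q where "Q = mixture (map m xs)"
  have Qadj: "adj Q = Q" by (simp add: Q_def)
  have "map ((*v) Y) (map m xs) = xs" using m by (simp add: map_idI)
  then have YQY: "Y ** Q ** adj Y = Y ** adj Y"
    using mixture_map_mult[of Y "map m xs"] mix Q_def by simp
  have Qker: "Q *v k = 0" if k: "Y *v k = 0" for k
  proof -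
    have "cip (m x) k = 0" if "x \<in> set xs" for x
      using mker[OF that k] by (simp add: cip_commute[of "m x"])
    then show ?thesis unfolding Q_def
      by (induction xs) (simp_all add: matrix_vector_mult_add_rdistrib ket_bra_vector)
  qed
  have QY: "Q *v (adj Y *v w) = adj Y *v w" for w
  proof -
    \<comment> \<open>The defect \<open>z\<close> lies in the kernel of \<open>Y\<close> because
      \<open>Y ** Q ** adj Y = Y ** adj Y\<close>, while both of its terms are orthogonal to that
      kernel. So \<open>z\<close> is orthogonal to itself.\<close>
    define z where "z = adj Y *v w - Q *v (adj Y *v w)"
    have "Y *v z = (Y ** adj Y) *v w - (Y ** Q ** adj Y) *v w"
      by (simp add: z_def matrix_vector_mult_diff_distrib matrix_vector_mul_assoc matrix_mul_assoc)
    then have Yz: "Y *v z = 0" by (simp add: YQY)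
    have "cip z (adj Y *v w) = 0" by (simp add: cip_matrix_right Yz)
    moreover have "cip z (Q *v (adj Y *v w)) = 0"
      by (simp add: cip_matrix_right Qadj Qker[OF Yz])
    ultimately have "cip z z = 0" by (metis cip_diff_right diff_0_right z_def)
    then show ?thesis by (simp add: cip_self_eq_0 z_def)
  qed
  then have "Q ** adj Y = adj Y" by (simp add: matrix_eq matrix_vector_mul_assoc[symmetric])
  then have YQ: "Y ** Q = Y" by (metis Qadj adj_adj adj_mult)
  have YP: "Y ** (mat 1 - Q) = 0"
    by (simp add: matrix_eq matrix_vector_mul_assoc[symmetric] matrix_vector_mult_diff_rdistrib
        matrix_vector_mult_diff_distrib) (simp add: matrix_vector_mul_assoc YQ)
  have "Q ** (mat 1 - Q) = 0"
    using YP Qker by (simp add: matrix_eq matrix_vector_mul_assoc[symmetric])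
  then have PP: "(mat 1 - Q) ** (mat 1 - Q) = mat 1 - Q"
    by (simp add: matrix_eq matrix_vector_mul_assoc[symmetric] matrix_vector_mult_diff_rdistrib)
  show ?thesis
    using that[of m "mat 1 - Q"] m YP PP Qadj by (simp add: Q_def adj_diff)
qed

section \<open>Determinants\<close>

lemma det_adj: "det (adj A) = cnj (det (A :: complex ^ 'n::finite ^ 'n))"
proof -
  have "det (adj A) = det (transpose (adj A))" by simp
  also have "\<dots> = cnj (det A)"
    by (simp only: det_def transpose_def adj_def) simp
  finally show ?thesis .
qed

lemma det_scaleR: "det (c *\<^sub>R A) = of_real c ^ CARD('n) * det (A :: complex ^ 'n::finite ^ 'n)"
proof -
  have "c *\<^sub>R A = (\<chi> i. of_real c *s A $ i)"
    by (simp add: vec_eq_iff scaleR_conv_of_real[where 'a = complex])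
  then show ?thesis using det_rows_mul[of "\<lambda>_. of_real c" "\<lambda>i. A $ i"] by simp
qed

lemma det_scale: "det (\<chi> i j. c * A $ i $ j) = c ^ CARD('n) * det (A :: complex ^ 'n::finite ^ 'n)"
proof -
  have "(\<chi> i j. c * A $ i $ j) = (\<chi> i. c *s A $ i)"
    by (simp add: vec_eq_iff)
  then show ?thesis using det_rows_mul[of "\<lambda>_. c" "\<lambda>i. A $ i"] by simp
qed

lemma continuous_on_det:
  fixes f :: "'a::topological_space \<Rightarrow> complex ^ 'n::finite ^ 'n"
  assumes "continuous_on S f"
  shows "continuous_on S (\<lambda>x. det (f x))"
  unfolding det_def by (intro continuous_intros assms)

section \<open>Hadamard's inequality combined with AM-GM\<close>

lemma norm_matrix_rows:
  "(norm (M :: complex ^ 'n::finite ^ 'm::finite))\<^sup>2 = (\<Sum>i\<in>UNIV. (norm (M $ i))\<^sup>2)"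
  by (simp add: power2_norm_eq_inner inner_vec_def)

text \<open>AM-GM for a mean of at most 1, obtained by multiplying the bounds
  \<open>a i \<le> exp (a i - 1)\<close>.\<close>

lemma prod_le_1_if_sum_le:
  fixes a :: "'i::finite \<Rightarrow> real"
  assumes "\<And>i. a i \<ge> 0" "(\<Sum>i\<in>UNIV. a i) \<le> CARD('i)"
  shows "(\<Prod>i\<in>UNIV. a i) \<le> 1"
proof -
  have "(\<Prod>i\<in>UNIV. a i) \<le> (\<Prod>i\<in>UNIV. exp (a i - 1))"
    using assms(1) by (intro prod_mono) (use exp_ge_add_one_self[of "a _ - 1"] in auto)
  also have "\<dots> = exp (\<Sum>i\<in>UNIV. a i - 1)" by (simp add: exp_sum)
  also have "\<dots> \<le> 1" using assms(2) by (simp add: sum_subtractf)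
  finally show ?thesis .
qed

text \<open>A maximiser of \<open>\<bar>det\<bar>\<close> on a Frobenius ball has orthogonal rows: otherwise subtracting from one
  row its projection onto another keeps the determinant and leaves room for scaling up.\<close>

lemma norm_det_le_1:
  fixes N :: "complex ^ 'n::finite ^ 'n"
  assumes "norm N \<le> sqrt CARD('n)"
  shows "norm (det N) \<le> 1"
proof -
  let ?K = "cball (0 :: complex ^ 'n ^ 'n) (sqrt CARD('n))"
  have "continuous_on ?K (\<lambda>M. norm (det M))"
    by (intro continuous_intros continuous_on_det)
  moreover have "?K \<noteq> {}" using assms by auto
  ultimately obtain M where M: "M \<in> ?K" and max: "\<And>M'. M' \<in> ?K \<Longrightarrow> norm (det M') \<le> norm (det M)"
    using continuous_attains_sup[OF compact_cball] by metis
  \<comment> \<open>The identity lies on the boundary of the ball, so the maximum is at least 1. A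
    nonzero determinant is what makes the later increase by scaling strict.\<close>
  have "(norm (mat 1 :: complex ^ 'n ^ 'n))\<^sup>2 = CARD('n)"
  proof -
    have "complex_of_real ((norm (mat 1 :: complex ^ 'n ^ 'n))\<^sup>2) = of_real CARD('n)"
      by (simp only: trace_adj_mult_self[symmetric]) (simp add: trace_I)
    then show ?thesis by (simp only: of_real_eq_iff)
  qed
  then have "(mat 1 :: complex ^ 'n ^ 'n) \<in> ?K"
    by (simp add: real_le_rsqrt)
  then have ge1: "norm (det M) \<ge> 1" using max by fastforce
  have orth: "cip (M $ j) (M $ i) = 0" if ij: "i \<noteq> j" for i j
  proof (rule ccontr)
    assume ne: "cip (M $ j) (M $ i) \<noteq> 0"
    then have j0: "M $ j \<noteq> 0" by auto
    \<comment> \<open>The Gram-Schmidt coefficient: \<open>v\<close> is row \<open>i\<close> without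
      its component along row \<open>j\<close>, hence strictly shorter.\<close>
    define r where "r = cip (M $ j) (M $ i) / cip (M $ j) (M $ j)"
    define v where "v = M $ i - r *s M $ j"
    have rj: "cip (M $ j) v = 0"
      using j0 by (simp add: v_def r_def cip_diff_right cip_scale_right cip_self_eq_0)
    have jr: "cip v (M $ j) = 0"
      using rj by (subst cip_commute) simp
    have Mi: "M $ i = v + r *s M $ j" by (simp add: v_def)
    have "cip (M $ i) (M $ i) = cip v v + cip (r *s M $ j) (r *s M $ j)"
      unfolding Mi using rj jr
      by (simp add: cip_add_left cip_add_right cip_scale_left cip_scale_right)
    then have "(norm (M $ i))\<^sup>2 = (norm v)\<^sup>2 + (norm (r *s M $ j))\<^sup>2"
      unfolding cip_self by (simp only: of_real_add[symmetric] of_real_eq_iff)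
    moreover have "r *s M $ j \<noteq> 0"
      using ne j0 by (simp add: r_def cip_self_eq_0)
    ultimately have lt: "(norm v)\<^sup>2 < (norm (M $ i))\<^sup>2" by simp
    then have lt': "norm v < norm (M $ i)" by (rule power2_less_imp_less) simp
    define M' where "M' = (\<chi> k. if k = i then v else M $ k)"
    have "M' = (\<chi> k. if k = i then row i M + (- r) *s row j M else row k M)"
      by (simp add: M'_def v_def vec_eq_iff row_def)
    then have det: "det M' = det M" using det_row_operation[OF ij, of M "- r"] by simp
    have "(norm M')\<^sup>2 < (norm M)\<^sup>2"
      unfolding norm_matrix_rows
      by (rule sum_strict_mono_ex1) (use lt lt' in \<open>auto simp: M'_def\<close>)
    then have "norm M' < norm M" by (rule power2_less_imp_less) simp
    then have lt': "norm M' < sqrt CARD('n)" using M by simp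
    have M'0: "M' \<noteq> 0"
    proof
      assume "M' = 0"
      then have "det M' = 0" using det_scaleR[of 0 "mat 1 :: complex ^ 'n ^ 'n"] by simp
      with det ge1 show False by simp
    qed
    \<comment> \<open>Scaling \<open>M'\<close> back to the boundary multiplies the modulus of the
      determinant by a power of \<open>s > 1\<close>, contradicting maximality.\<close>
    define s where "s = sqrt CARD('n) / norm M'"
    have s1: "s > 1" using lt' M'0 by (simp add: s_def)
    then have "s *\<^sub>R M' \<in> ?K" using M'0 by (simp add: s_def)
    from max[OF this] have "s ^ CARD('n) * norm (det M) \<le> norm (det M)"
      using s1 by (simp add: det_scaleR norm_mult norm_power det)
    moreover have "s ^ CARD('n) > 1" using s1 by (simp add: one_less_power)
    ultimately show False
      using ge1 mult_strict_right_mono[of 1 "s ^ CARD('n)" "norm (det M)"] by linarith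
  qed
  have ent: "(M ** adj M) $ i $ j = cip (M $ j) (M $ i)" for i j
    by (simp add: matrix_matrix_mult_def adj_def cip_def mult.commute)
  \<comment> \<open>Orthogonal rows make the Gram matrix diagonal, so the squared determinant is the
    product of the squared row lengths.\<close>
  have "of_real ((norm (det M))\<^sup>2) = det (M ** adj M)"
    by (simp only: det_mul det_adj complex_norm_square)
  also have "\<dots> = (\<Prod>i\<in>UNIV. cip (M $ i) (M $ i))"
    using det_diagonal[of "M ** adj M"] orth by (simp add: ent)
  also have "\<dots> = of_real (\<Prod>i\<in>UNIV. (norm (M $ i))\<^sup>2)" by (simp add: cip_self)
  finally have "(norm (det M))\<^sup>2 = (\<Prod>i\<in>UNIV. (norm (M $ i))\<^sup>2)"
    by (simp only: of_real_eq_iff)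
  also have "\<dots> \<le> 1"
  proof (rule prod_le_1_if_sum_le)
    have "(norm M)\<^sup>2 \<le> (sqrt CARD('n))\<^sup>2" using M by (intro power_mono) auto
    then show "(\<Sum>i\<in>UNIV. (norm (M $ i))\<^sup>2) \<le> CARD('n)" by (simp add: norm_matrix_rows)
  qed simp
  finally have "norm (det M) \<le> 1" by (simp add: abs_square_le_1)
  moreover have "norm (det N) \<le> norm (det M)" using max assms by simp
  ultimately show ?thesis by linarith
qed

text \<open>The norm is the Frobenius norm. Both sides are homogeneous of degree two, so rescaling a
  nonzero \<open>M\<close> to norm \<open>sqrt CARD('n)\<close> reduces the claim to
  \<open>norm_det_le_1\<close>.\<close>

lemma root_det_le:
  fixes M :: "complex ^ 'n::finite ^ 'n"
  shows "root CARD('n) ((norm (det M))\<^sup>2) \<le> (norm M)\<^sup>2 / CARD('n)"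
proof (cases "M = 0")
  case True
  then have "det M = 0" using det_scaleR[of 0 "mat 1 :: complex ^ 'n ^ 'n"] by simp
  then show ?thesis by simp
next
  case False
  define s where "s = sqrt CARD('n) / norm M"
  have s: "s > 0" using False by (simp add: s_def)
  have "norm (det (s *\<^sub>R M)) \<le> 1"
    by (rule norm_det_le_1) (use False in \<open>simp add: s_def\<close>)
  then have "(s ^ CARD('n) * norm (det M))\<^sup>2 \<le> 1"
    using s by (simp add: det_scaleR norm_mult norm_power abs_square_le_1)
  then have "(s\<^sup>2) ^ CARD('n) * (norm (det M))\<^sup>2 \<le> 1"
    by (simp add: power_mult_distrib power_mult[symmetric] mult.commute)
  then have "(norm (det M))\<^sup>2 \<le> (1 / s\<^sup>2) ^ CARD('n)"
    using s by (simp add: field_simps)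
  then have "root CARD('n) ((norm (det M))\<^sup>2) \<le> root CARD('n) ((1 / s\<^sup>2) ^ CARD('n))"
    by simp
  also have "\<dots> = 1 / s\<^sup>2" using s by (simp add: real_root_power_cancel)
  also have "\<dots> = (norm M)\<^sup>2 / CARD('n)" by (simp add: s_def power_divide)
  finally show ?thesis .
qed

section \<open>The G-concurrence of vectors\<close>

lemma G_pure_eq:
  "G_pure \<phi> = CARD('d) * root CARD('d) ((norm (det (coeff_matrix \<phi>)))\<^sup>2)"
  for \<phi> :: "complex ^ ('d::finite \<times> 'd)"
proof -
  have "det (adj (coeff_matrix \<phi>) ** coeff_matrix \<phi>) = of_real ((norm (det (coeff_matrix \<phi>)))\<^sup>2)"
    by (simp only: complex_norm_square det_mul det_adj mult.commute)
  then show ?thesis by (simp only: G_pure_def Re_complex_of_real)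
qed

lemma G_pure_nonneg: "G_pure \<phi> \<ge> 0"
  by (simp add: G_pure_eq)

lemma G_pure_scale: "G_pure (c *s x) = (norm c)\<^sup>2 * G_pure x"
  for x :: "complex ^ ('d::finite \<times> 'd)"
proof -
  have "coeff_matrix (c *s x) = (\<chi> i j. c * coeff_matrix x $ i $ j)"
    by (simp add: coeff_matrix_def vec_eq_iff)
  then have "(norm (det (coeff_matrix (c *s x))))\<^sup>2
      = ((norm c)\<^sup>2) ^ CARD('d) * (norm (det (coeff_matrix x)))\<^sup>2"
    by (simp add: det_scale norm_mult norm_power power_mult_distrib power_mult[symmetric]
        mult.commute)
  then show ?thesis
    by (simp add: G_pure_eq real_root_mult real_root_power_cancel)
qed

lemma G_pure_scaleR: "G_pure (c *\<^sub>R x) = c\<^sup>2 * G_pure x"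
  by (simp add: scaleR_eq_smult G_pure_scale)

lemma norm_coeff_matrix: "norm (coeff_matrix x) = norm x"
proof -
  have "(norm (coeff_matrix x))\<^sup>2 = (\<Sum>i\<in>UNIV. \<Sum>j\<in>UNIV. (norm (x $ (i, j)))\<^sup>2)"
    by (simp add: power2_norm_eq_inner inner_vec_def coeff_matrix_def)
  also have "\<dots> = (\<Sum>a\<in>UNIV. (norm (x $ a))\<^sup>2)"
    by (simp add: sum.cartesian_product UNIV_Times_UNIV[symmetric] del: UNIV_Times_UNIV)
  also have "\<dots> = (norm x)\<^sup>2"
    by (simp add: power2_norm_eq_inner inner_vec_def)
  finally show ?thesis by simp
qed

text \<open>Bounds the sum of \<open>G_pure\<close> over a decomposition by its trace, so the
  supremum in \<open>assist\<close> is finite.\<close>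

lemma G_pure_le: "G_pure x \<le> (norm x)\<^sup>2"
  for x :: "complex ^ ('d::finite \<times> 'd)"
  using root_det_le[of "coeff_matrix x"]
  by (simp add: G_pure_eq norm_coeff_matrix field_simps)

lemma continuous_on_G_pure: "continuous_on S G_pure"
  for S :: "(complex ^ ('d::finite \<times> 'd)) set"
proof -
  have "continuous_on S (coeff_matrix :: complex ^ ('d \<times> 'd) \<Rightarrow> complex ^ 'd ^ 'd)"
    unfolding coeff_matrix_def by (intro continuous_intros)
  from continuous_on_det[OF this] show ?thesis
    unfolding G_pure_eq by (intro continuous_intros)
qed

lemma coeff_matrix_left: "coeff_matrix ((M \<otimes>\<^sub>K mat 1) *v x) = M ** coeff_matrix x"
proof -
  have "(\<Sum>y\<in>UNIV. M $ i $ fst y * mat 1 $ j $ snd y * x $ y) = (\<Sum>k\<in>UNIV. M $ i $ k * x $ (k, j))"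
    for i j
  proof -
    have "(\<Sum>y\<in>UNIV. M $ i $ fst y * mat 1 $ j $ snd y * x $ y)
        = (\<Sum>k\<in>UNIV. \<Sum>l\<in>UNIV. M $ i $ k * mat 1 $ j $ l * x $ (k, l))"
      by (simp add: sum.cartesian_product UNIV_Times_UNIV[symmetric] case_prod_beta
          del: UNIV_Times_UNIV)
    then show ?thesis by (simp add: mat_def if_distrib if_distribR cong: if_cong)
  qed
  then show ?thesis
    by (simp add: coeff_matrix_def kron_def matrix_vector_mult_def matrix_matrix_mult_def vec_eq_iff)
qed

lemma coeff_matrix_right: "coeff_matrix ((mat 1 \<otimes>\<^sub>K M) *v x) = coeff_matrix x ** transpose M"
proof -
  have "(\<Sum>y\<in>UNIV. mat 1 $ i $ fst y * M $ j $ snd y * x $ y) = (\<Sum>l\<in>UNIV. x $ (i, l) * M $ j $ l)"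
    for i j
  proof -
    have "(\<Sum>y\<in>UNIV. mat 1 $ i $ fst y * M $ j $ snd y * x $ y)
        = (\<Sum>k\<in>UNIV. \<Sum>l\<in>UNIV. mat 1 $ i $ k * M $ j $ l * x $ (k, l))"
      by (simp add: sum.cartesian_product UNIV_Times_UNIV[symmetric] case_prod_beta
          del: UNIV_Times_UNIV)
    also have "\<dots> = (\<Sum>l\<in>UNIV. \<Sum>k\<in>UNIV. mat 1 $ i $ k * M $ j $ l * x $ (k, l))"
      by (rule sum.swap)
    finally show ?thesis
      by (simp add: mat_def if_distrib if_distribR mult.commute cong: if_cong)
  qed
  then show ?thesis
    by (simp add: coeff_matrix_def kron_def matrix_vector_mult_def matrix_matrix_mult_def
        transpose_def vec_eq_iff)
qed

text \<open>On coefficient matrices A multiplies from the left and B by the transpose from the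
  right, and determinants are multiplicative.\<close>

lemma G_pure_local:
  fixes M :: "('d::finite) op"
  shows "G_pure ((M \<otimes>\<^sub>K mat 1) *v x) = root CARD('d) ((norm (det M))\<^sup>2) * G_pure x"
    and "G_pure ((mat 1 \<otimes>\<^sub>K M) *v x) = root CARD('d) ((norm (det M))\<^sup>2) * G_pure x"
  by (simp_all add: G_pure_eq coeff_matrix_left coeff_matrix_right det_mul norm_mult
      power_mult_distrib real_root_mult)

text \<open>The trace of the completeness relation says that the squared Frobenius norms add up to
  the dimension, which cancels the denominator in \<open>root_det_le\<close>. The roots are the
  factors by which Kraus operators of A or B rescale \<open>G_pure\<close>.\<close>

lemma kraus_root_det_le_1:
  fixes Ms :: "('d::finite) op list"
  assumes "(\<Sum>M\<leftarrow>Ms. adj M ** M) = mat 1"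
  shows "(\<Sum>M\<leftarrow>Ms. root CARD('d) ((norm (det M))\<^sup>2)) \<le> 1"
proof -
  have "(\<Sum>M\<leftarrow>Ms. root CARD('d) ((norm (det M))\<^sup>2)) \<le> (\<Sum>M\<leftarrow>Ms. (norm M)\<^sup>2 / CARD('d))"
    by (intro sum_list_mono root_det_le)
  also have "\<dots> = (\<Sum>M\<leftarrow>Ms. (norm M)\<^sup>2) / CARD('d)"
    by (induction Ms) (simp_all add: add_divide_distrib)
  also have "(\<Sum>M\<leftarrow>Ms. (norm M)\<^sup>2) = CARD('d)"
  proof -
    have "trace (\<Sum>M\<leftarrow>Ms. adj M ** M) = of_real (\<Sum>M\<leftarrow>Ms. (norm M)\<^sup>2)"
    proof (induction Ms)
      case (Cons M Ms)
      then show ?case by (simp add: trace_add trace_adj_mult_self)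
    qed (simp add: trace_def)
    then have "complex_of_real (\<Sum>M\<leftarrow>Ms. (norm M)\<^sup>2) = of_real CARD('d)"
      by (simp only: assms trace_I of_real_of_nat_eq)
    then show ?thesis by (simp only: of_real_eq_iff)
  qed
  finally show ?thesis by simp
qed

section \<open>Assistance for unnormalised operators\<close>

text \<open>The supremum is over a nonempty set only if \<open>\<tau>\<close> is a mixture. This is
  why the lemmas below carry some decomposition as a witness.\<close>

definition assist :: "('d::finite \<times> 'd) op \<Rightarrow> real" where
  "assist \<tau> = Sup {\<Sum>x\<leftarrow>xs. G_pure x | xs. mixture xs = \<tau>}"

lemma sum_G_pure_le_trace:
  "mixture xs = \<tau> \<Longrightarrow> (\<Sum>x\<leftarrow>xs. G_pure x) \<le> Re (trace \<tau>)"
  using trace_mixture[of xs] sum_list_mono[of xs G_pure "\<lambda>x. (norm x)\<^sup>2"] G_pure_le by auto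

lemma assist_upper: "mixture xs = \<tau> \<Longrightarrow> (\<Sum>x\<leftarrow>xs. G_pure x) \<le> assist \<tau>"
  unfolding assist_def
  by (intro cSup_upper bdd_aboveI[of _ "Re (trace \<tau>)"]) (auto intro: sum_G_pure_le_trace)

lemma assist_least:
  assumes "mixture ys = \<tau>" "\<And>xs. mixture xs = \<tau> \<Longrightarrow> (\<Sum>x\<leftarrow>xs. G_pure x) \<le> b"
  shows "assist \<tau> \<le> b"
  unfolding assist_def by (rule cSup_least) (use assms in auto)

lemma assist_nonneg: "mixture xs = \<tau> \<Longrightarrow> assist \<tau> \<ge> 0"
  using assist_upper[of xs \<tau>] by (rule order_trans[rotated]) (auto intro!: sum_list_nonneg G_pure_nonneg)

text \<open>Concatenating decompositions of the summands decomposes the sum. The two suprema are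
  taken one after the other, with the other decomposition held fixed.\<close>

lemma assist_add:
  assumes "mixture xs = \<sigma>" "mixture ys = \<tau>"
  shows "assist \<sigma> + assist \<tau> \<le> assist (\<sigma> + \<tau>)"
proof -
  have "assist \<sigma> \<le> assist (\<sigma> + \<tau>) - assist \<tau>"
  proof (rule assist_least[OF assms(1)])
    fix us assume us: "mixture us = \<sigma>"
    have "assist \<tau> \<le> assist (\<sigma> + \<tau>) - (\<Sum>x\<leftarrow>us. G_pure x)"
    proof (rule assist_least[OF assms(2)])
      fix vs assume "mixture vs = \<tau>"
      with us show "(\<Sum>x\<leftarrow>vs. G_pure x) \<le> assist (\<sigma> + \<tau>) - (\<Sum>x\<leftarrow>us. G_pure x)"
        using assist_upper[of "us @ vs" "\<sigma> + \<tau>"] by simp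
    qed
    then show "(\<Sum>x\<leftarrow>us. G_pure x) \<le> assist (\<sigma> + \<tau>) - assist \<tau>" by simp
  qed
  then show ?thesis by simp
qed

text \<open>Stretching every vector by \<open>sqrt c\<close> multiplies each \<open>G_pure\<close>
  by \<open>c\<close>. This direction is the one that absorbs an outcome probability.\<close>

lemma assist_scaleR:
  assumes "mixture ys = \<tau>" "c > 0"
  shows "c * assist \<tau> \<le> assist (c *\<^sub>R \<tau>)"
proof -
  have "assist \<tau> \<le> assist (c *\<^sub>R \<tau>) / c"
  proof (rule assist_least[OF assms(1)])
    fix xs assume xs: "mixture xs = \<tau>"
    have "mixture (map (\<lambda>x. sqrt c *\<^sub>R x) xs) = c *\<^sub>R mixture xs"
      using assms(2) by (induction xs) (simp_all add: ket_bra_scaleR scaleR_add_right)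
    from assist_upper[OF this] have "(\<Sum>x\<leftarrow>xs. c * G_pure x) \<le> assist (c *\<^sub>R \<tau>)"
      using assms(2) by (simp add: G_pure_scaleR o_def xs)
    then show "(\<Sum>x\<leftarrow>xs. G_pure x) \<le> assist (c *\<^sub>R \<tau>) / c"
      using assms(2) by (simp add: sum_list_const_mult field_simps)
  qed
  then show ?thesis using assms(2) by (simp add: field_simps)
qed

text \<open>The columns of \<open>Y\<close> form such a list. The usual source of the witness that
  \<open>assist\<close> requires.\<close>

lemma mixture_columns:
  fixes Y :: "complex ^ 'n::finite ^ 'i::finite"
  obtains xs where "mixture xs = Y ** adj Y"
proof -
  obtain l :: "'n list" where l: "set l = UNIV" "distinct l"
    using finite_distinct_list[of "UNIV :: 'n set"] by auto
  have "mixture (map (\<lambda>s. column s Y) l) = (\<Sum>s\<in>UNIV. ket_bra (column s Y))"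
    using l by (simp add: mixture_def o_def sum_list_distinct_conv_sum_set)
  also have "\<dots> = Y ** adj Y"
    by (simp add: vec_eq_iff matrix_matrix_mult_def adj_def ket_bra_def column_def sum_component)
  finally show ?thesis using that by blast
qed

lemma mixture_sum_gram:
  fixes Ys :: "(complex ^ 'n::finite ^ 'i::finite) list"
  obtains xs where "mixture xs = (\<Sum>Y\<leftarrow>Ys. Y ** adj Y)"
proof (induction Ys arbitrary: thesis)
  case Nil
  then show ?case by (auto intro: Nil[of "[]"])
next
  case (Cons Y Ys)
  obtain xs where "mixture xs = Y ** adj Y" by (rule mixture_columns)
  moreover obtain ys where "mixture ys = (\<Sum>Y\<leftarrow>Ys. Y ** adj Y)" by (rule Cons.IH)
  ultimately show ?case by (auto intro: Cons.prems[of "xs @ ys"])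
qed

lemma assist_sum_list:
  fixes Ys :: "(complex ^ 'n::finite ^ ('d::finite \<times> 'd)) list"
  shows "(\<Sum>Y\<leftarrow>Ys. assist (Y ** adj Y)) \<le> assist (\<Sum>Y\<leftarrow>Ys. Y ** adj Y)"
proof (induction Ys)
  case Nil
  show ?case using assist_nonneg[of "[]" 0] by simp
next
  case (Cons Y Ys)
  obtain xs where "mixture xs = Y ** adj Y" by (rule mixture_columns)
  moreover obtain ys where "mixture ys = (\<Sum>Y\<leftarrow>Ys. Y ** adj Y)" by (rule mixture_sum_gram)
  ultimately have "assist (Y ** adj Y) + assist (\<Sum>Y\<leftarrow>Ys. Y ** adj Y)
      \<le> assist (Y ** adj Y + (\<Sum>Y\<leftarrow>Ys. Y ** adj Y))"
    by (rule assist_add)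
  with Cons show ?case by simp
qed

text \<open>A decomposition of \<open>L \<tau> L\<^sup>\<dagger>\<close> consists of vectors \<open>L y\<close> where the \<open>y\<close> can be completed to a
  decomposition of \<open>\<tau>\<close>; no invertibility of \<open>L\<close> is needed.\<close>

lemma assist_filter:
  fixes Y :: "complex ^ 'n::finite ^ ('d::finite \<times> 'd)"
  assumes G: "\<And>y. G_pure (L *v y) = c * G_pure y" and c: "c \<ge> 0"
  shows "assist ((L ** Y) ** adj (L ** Y)) \<le> c * assist (Y ** adj Y)"
proof -
  obtain ys where "mixture ys = (L ** Y) ** adj (L ** Y)" by (rule mixture_columns)
  then show ?thesis
  proof (rule assist_least)
    fix xs assume "mixture xs = (L ** Y) ** adj (L ** Y)"
    then obtain m P where m: "\<And>x. x \<in> set xs \<Longrightarrow> (L ** Y) *v m x = x"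
      and mP: "mixture (map m xs) + P = mat 1" and "L ** Y ** P = 0" and P: "adj P = P" "P ** P = P"
      by (rule mixture_freedom) blast
    obtain zs where zs: "mixture zs = (Y ** P) ** adj (Y ** P)" by (rule mixture_columns)
    define ws where "ws = map ((*v) Y) (map m xs)"
    have "mixture (ws @ zs) = Y ** mixture (map m xs) ** adj Y + (Y ** P) ** adj (Y ** P)"
      unfolding ws_def using zs by (simp add: mixture_map_mult del: map_map)
    also have "(Y ** P) ** adj (Y ** P) = Y ** P ** adj Y"
      by (metis P adj_mult matrix_mul_assoc)
    also have "Y ** mixture (map m xs) ** adj Y + Y ** P ** adj Y = Y ** adj Y"
      by (simp add: matrix_add_rdistrib[symmetric] matrix_add_ldistrib[symmetric] mP)
    finally have "(\<Sum>x\<leftarrow>ws @ zs. G_pure x) \<le> assist (Y ** adj Y)" by (rule assist_upper)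
    moreover have "(\<Sum>x\<leftarrow>zs. G_pure x) \<ge> 0"
      by (intro sum_list_nonneg) (auto simp: G_pure_nonneg)
    ultimately have "(\<Sum>x\<leftarrow>ws. G_pure x) \<le> assist (Y ** adj Y)" by simp
    then have "c * (\<Sum>x\<leftarrow>ws. G_pure x) \<le> c * assist (Y ** adj Y)"
      using c by (rule mult_left_mono)
    moreover have "c * (\<Sum>x\<leftarrow>ws. G_pure x) = (\<Sum>x\<leftarrow>xs. G_pure x)"
      using m unfolding ws_def
      by (induction xs) (simp_all add: algebra_simps G[symmetric] matrix_vector_mul_assoc)
    ultimately show "(\<Sum>x\<leftarrow>xs. G_pure x) \<le> c * assist (Y ** adj Y)" by simp
  qed
qed

section \<open>Amplitude matrices: A and B act from the left, S from the right\<close>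

definition amp :: "complex ^ ('d::finite \<times> 'd \<times> 'n::finite) \<Rightarrow> complex ^ 'n ^ ('d \<times> 'd)" where
  "amp \<psi> = (\<chi> a s. \<psi> $ (fst a, snd a, s))"

lemma ptrace_ket_bra: "ptrace_S (ket_bra \<psi>) = amp \<psi> ** adj (amp \<psi>)"
  by (simp add: ptrace_S_def ket_bra_def amp_def adj_def matrix_matrix_mult_def vec_eq_iff)

lemma sum_UNIV_triple:
  "(\<Sum>y\<in>UNIV. f y) = (\<Sum>a\<in>UNIV. \<Sum>b\<in>UNIV. \<Sum>s\<in>UNIV. f (a :: 'a::finite, b :: 'b::finite, s :: 'c::finite))"
  by (simp add: sum.cartesian_product UNIV_Times_UNIV[symmetric] case_prod_beta
      del: UNIV_Times_UNIV)

lemma sum_UNIV_pair: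
  "(\<Sum>y\<in>UNIV. f y) = (\<Sum>a\<in>UNIV. \<Sum>b\<in>UNIV. f (a :: 'a::finite, b :: 'b::finite))"
  by (simp add: sum.cartesian_product UNIV_Times_UNIV[symmetric] case_prod_beta
      del: UNIV_Times_UNIV)

lemma mat_1_mult:
  "mat 1 $ i $ j * z = (if j = i then z else (0::complex))"
  "z * mat 1 $ i $ j = (if j = i then z else (0::complex))"
  by (simp_all add: mat_def)

lemma mult_if_0:
  "z * (if P then w else 0) = (if P then z * w else (0::complex))"
  "(if P then w else 0) * z = (if P then w * z else (0::complex))"
  "(\<Sum>i\<in>A. if P then f i else 0) = (if P then \<Sum>i\<in>A. f i else (0::complex))"
  by simp_all

lemma amp_on_A: "amp (on_A M *v \<psi>) = (M \<otimes>\<^sub>K mat 1) ** amp \<psi>"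
  by (simp add: amp_def on_A_def kron_def matrix_vector_mult_def matrix_matrix_mult_def vec_eq_iff
      sum_UNIV_triple sum_UNIV_pair mat_1_mult mult_if_0 cong: if_cong)

lemma amp_on_B: "amp (on_B M *v \<psi>) = (mat 1 \<otimes>\<^sub>K M) ** amp \<psi>"
  by (simp add: amp_def on_B_def kron_def matrix_vector_mult_def matrix_matrix_mult_def vec_eq_iff
      sum_UNIV_triple sum_UNIV_pair mat_1_mult mult_if_0 cong: if_cong)

lemma amp_on_S: "amp (on_S M *v \<psi>) = amp \<psi> ** transpose M"
proof -
  have "amp (on_S M *v \<psi>) $ a $ s = (\<Sum>k\<in>UNIV. M $ s $ k * amp \<psi> $ a $ k)" for a s
    by (simp add: amp_def on_S_def kron_def matrix_vector_mult_def sum_UNIV_triple mat_1_mult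
        mult_if_0 cong: if_cong)
  then show ?thesis
    by (simp add: vec_eq_iff matrix_matrix_mult_def transpose_def mult.commute)
qed

text \<open>S acts on amplitudes by transposes, whose Gram products are the transposes of
  \<open>adj M ** M\<close>. Completeness thus expresses that S splits the reduced state of A and B
  without changing it.\<close>

lemma sum_gram_on_S:
  assumes "(\<Sum>M\<leftarrow>Ms. adj M ** M) = mat 1"
  shows "(\<Sum>M\<leftarrow>Ms. (Y ** transpose M) ** adj (Y ** transpose M)) = Y ** adj Y"
proof -
  have tr: "(Y ** transpose M) ** adj (Y ** transpose M) = Y ** transpose (adj M ** M) ** adj Y" for M
  proof -
    have "transpose (adj M) = adj (transpose M)" by (simp add: adj_def transpose_def)
    then show ?thesis by (simp add: adj_mult matrix_transpose_mul matrix_mul_assoc)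
  qed
  have "(\<Sum>M\<leftarrow>Ms. (Y ** transpose M) ** adj (Y ** transpose M))
      = Y ** transpose (\<Sum>M\<leftarrow>Ms. adj M ** M) ** adj Y"
  proof (induction Ms)
    case Nil
    show ?case by (simp add: transpose_def vec_eq_iff matrix_matrix_mult_def)
  next
    case (Cons M Ms)
    have "transpose (A + B) = transpose A + transpose B" for A B :: "complex ^ 'a ^ 'a"
      by (simp add: transpose_def vec_eq_iff)
    with Cons show ?case
      by (simp add: tr matrix_add_ldistrib matrix_add_rdistrib)
  qed
  with assms show ?thesis by simp
qed

text \<open>One round on an unnormalised vector, with outcomes refined to single Kraus operators;
  probabilities are hidden in the lengths. For A and B the factors from \<open>assist_filter\<close>
  sum to at most 1, for S superadditivity suffices.\<close>

lemma assist_local_operation: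
  fixes \<psi> :: "complex ^ ('d::finite \<times> 'd \<times> 'n::finite)"
  assumes "local_operation F"
  shows "(\<Sum>M\<leftarrow>concat F. assist (ptrace_S (ket_bra (M *v \<psi>)))) \<le> assist (ptrace_S (ket_bra \<psi>))"
proof -
  let ?Y = "amp \<psi>"
  obtain xs where "mixture xs = ?Y ** adj ?Y" by (rule mixture_columns)
  then have nonneg: "assist (?Y ** adj ?Y) \<ge> 0" by (rule assist_nonneg)
  \<comment> \<open>\<open>L\<close> embeds the operators of one party into those of A and B
    together, so A and B are treated at once.\<close>
  have one_party: "(\<Sum>M\<leftarrow>Ms. assist ((L M ** ?Y) ** adj (L M ** ?Y))) \<le> assist (?Y ** adj ?Y)"
    if G: "\<And>M x. G_pure (L M *v x) = root CARD('d) ((norm (det M))\<^sup>2) * G_pure x"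
      and Ms: "(\<Sum>M\<leftarrow>Ms. adj M ** M) = mat 1"
    for L :: "'d op \<Rightarrow> ('d \<times> 'd) op" and Ms
  proof -
    have "(\<Sum>M\<leftarrow>Ms. assist ((L M ** ?Y) ** adj (L M ** ?Y)))
        \<le> (\<Sum>M\<leftarrow>Ms. root CARD('d) ((norm (det M))\<^sup>2) * assist (?Y ** adj ?Y))"
      by (intro sum_list_mono assist_filter G) auto
    also have "\<dots> = (\<Sum>M\<leftarrow>Ms. root CARD('d) ((norm (det M))\<^sup>2)) * assist (?Y ** adj ?Y)"
      by (simp add: sum_list_mult_const)
    also have "\<dots> \<le> assist (?Y ** adj ?Y)"
      using mult_right_mono[OF kraus_root_det_le_1[OF Ms] nonneg] by simp
    finally show ?thesis .
  qed
  from assms consider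
      (A) Ms where "kraus_complete Ms" "F = map (map on_A) Ms"
    | (B) Ms where "kraus_complete Ms" "F = map (map on_B) Ms"
    | (S) Ms where "kraus_complete Ms" "F = map (map on_S) Ms"
    unfolding local_operation_def by blast
  then show ?thesis
  proof cases
    case A
    then show ?thesis
      using one_party[of "\<lambda>M. M \<otimes>\<^sub>K mat 1" "concat Ms"]
      by (simp add: kraus_complete_def map_concat[symmetric] o_def ptrace_ket_bra amp_on_A G_pure_local)
  next
    case B
    then show ?thesis
      using one_party[of "\<lambda>M. mat 1 \<otimes>\<^sub>K M" "concat Ms"]
      by (simp add: kraus_complete_def map_concat[symmetric] o_def ptrace_ket_bra amp_on_B G_pure_local)
  next
    case S
    then show ?thesis
      using assist_sum_list[of "map (\<lambda>M. ?Y ** transpose M) (concat Ms)"]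
        sum_gram_on_S[of "concat Ms" ?Y]
      by (simp add: kraus_complete_def map_concat[symmetric] o_def ptrace_ket_bra amp_on_S)
  qed
qed

section \<open>Decompositions into normalised vectors\<close>

lemma decomposition_of_mixture:
  assumes "mixture xs = \<rho>" "trace \<rho> = 1"
  obtains D where "is_decomposition \<rho> D" "avg_G D = (\<Sum>x\<leftarrow>xs. G_pure x)"
proof -
  \<comment> \<open>The zero vector has no direction; an arbitrary basis vector replaces it, with
    weight 0.\<close>
  define nrm where "nrm x = (if x = 0 then axis undefined 1 else (1 / norm x) *\<^sub>R x)"
    for x :: "complex ^ ('a \<times> 'a)"
  have nrm: "norm (nrm x) = 1" for x by (simp add: nrm_def)
  have x: "x = norm x *\<^sub>R nrm x" for x by (simp add: nrm_def)
  have kb: "(norm x)\<^sup>2 *\<^sub>R ket_bra (nrm x) = ket_bra x" for x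
    by (subst (3) x) (simp only: ket_bra_scaleR)
  have G: "(norm x)\<^sup>2 * G_pure (nrm x) = G_pure x" for x
    by (subst (3) x) (simp only: G_pure_scaleR)
  define D where "D = map (\<lambda>x. ((norm x)\<^sup>2, nrm x)) xs"
  have "complex_of_real (\<Sum>x\<leftarrow>xs. (norm x)\<^sup>2) = of_real 1"
    using assms by (simp only: trace_mixture[symmetric]) simp
  then have "(\<Sum>x\<leftarrow>xs. (norm x)\<^sup>2) = 1" by (simp only: of_real_eq_iff)
  then have "is_decomposition \<rho> D"
    unfolding is_decomposition_def D_def assms(1)[symmetric] mixture_def
    by (auto simp: nrm o_def kb)
  moreover have "avg_G D = (\<Sum>x\<leftarrow>xs. G_pure x)"
    by (simp add: avg_G_def D_def o_def G)
  ultimately show ?thesis by (rule that)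
qed

lemma mixture_of_decomposition:
  assumes "is_decomposition \<rho> D"
  obtains xs where "mixture xs = \<rho>" "(\<Sum>x\<leftarrow>xs. G_pure x) = avg_G D"
proof -
  define xs where "xs = map (\<lambda>(p, \<phi>). sqrt p *\<^sub>R \<phi>) D"
  have "mixture xs = (\<Sum>(p, \<phi>)\<leftarrow>D. p *\<^sub>R ket_bra \<phi>)"
    unfolding xs_def mixture_def map_map
    by (rule arg_cong[of _ _ sum_list], rule map_cong)
      (use assms in \<open>auto simp: is_decomposition_def ket_bra_scaleR\<close>)
  moreover have "(\<Sum>x\<leftarrow>xs. G_pure x) = avg_G D"
    unfolding xs_def avg_G_def map_map
    by (rule arg_cong[of _ _ sum_list], rule map_cong)
      (use assms in \<open>auto simp: is_decomposition_def G_pure_scaleR\<close>)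
  ultimately show ?thesis
    using that assms by (auto simp: is_decomposition_def)
qed

text \<open>Decompositions of any finite length become points of one convex hull, which opens the
  way to compactness.\<close>

lemma decomposition_iff_convex_hull:
  "(\<exists>D. is_decomposition \<rho> D \<and> avg_G D = t) \<longleftrightarrow>
    (\<rho>, t) \<in> convex hull ((\<lambda>\<phi>. (ket_bra \<phi>, G_pure \<phi>)) ` sphere 0 1)"
  (is "_ \<longleftrightarrow> _ \<in> convex hull ?S")
proof
  assume "\<exists>D. is_decomposition \<rho> D \<and> avg_G D = t"
  then obtain D where D: "is_decomposition \<rho> D" "avg_G D = t" by blast
  let ?v = "\<lambda>i. (ket_bra (snd (D ! i)), G_pure (snd (D ! i)))"
  have nth: "fst (D ! i) \<ge> 0 \<and> norm (snd (D ! i)) = 1" if "i < length D" for i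
    using D(1) nth_mem[OF that] by (auto simp: is_decomposition_def case_prod_beta)
  have "(\<Sum>i<length D. fst (D ! i) *\<^sub>R ?v i) \<in> convex hull ?S"
  proof (rule convex_sum)
    show "(\<Sum>i<length D. fst (D ! i)) = 1"
      using D(1) by (simp add: is_decomposition_def case_prod_beta sum_list_sum_nth atLeast0LessThan)
  qed (use nth in \<open>auto intro!: hull_inc\<close>)
  moreover have "(\<Sum>i<length D. fst (D ! i) *\<^sub>R ?v i) = (\<rho>, t)"
    using D by (auto simp: is_decomposition_def avg_G_def case_prod_beta sum_list_sum_nth
        atLeast0LessThan prod_eq_iff fst_sum snd_sum)
  ultimately show "(\<rho>, t) \<in> convex hull ?S" by simp
next
  assume "(\<rho>, t) \<in> convex hull ?S"
  then obtain T u where T: "finite T" "T \<subseteq> ?S" "\<forall>v\<in>T. 0 \<le> u v" "sum u T = 1"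
    and eq: "(\<Sum>v\<in>T. u v *\<^sub>R v) = (\<rho>, t)"
    unfolding convex_hull_explicit by blast
  have "\<exists>\<phi>. norm \<phi> = 1 \<and> v = (ket_bra \<phi>, G_pure \<phi>)" if "v \<in> T" for v
    using subsetD[OF T(2) that] by auto
  then obtain f where f: "\<And>v. v \<in> T \<Longrightarrow> norm (f v) = 1 \<and> v = (ket_bra (f v), G_pure (f v))"
    by metis
  then have f': "\<And>v. v \<in> T \<Longrightarrow> ket_bra (f v) = fst v" "\<And>v. v \<in> T \<Longrightarrow> G_pure (f v) = snd v"
    by (metis fst_conv, metis snd_conv)
  obtain l where l: "set l = T" "distinct l"
    using finite_distinct_list[OF T(1)] by auto
  define D where "D = map (\<lambda>v. (u v, f v)) l"
  have "(\<Sum>v\<in>T. u v *\<^sub>R fst v) = \<rho>" "(\<Sum>v\<in>T. u v * snd v) = t"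
    using arg_cong[OF eq, of fst] arg_cong[OF eq, of snd] by (simp_all add: fst_sum snd_sum)
  then have "is_decomposition \<rho> D" "avg_G D = t"
    using T f l by (auto simp: is_decomposition_def avg_G_def D_def o_def f'
        sum_list_distinct_conv_sum_set cong: sum.cong)
  then show "\<exists>D. is_decomposition \<rho> D \<and> avg_G D = t" by blast
qed

text \<open>The hull of a compact set in finite dimension is compact, and the averages over
  \<open>\<rho>\<close> are its slice at \<open>\<rho>\<close>. Hence extrema over decompositions
  are attained whenever one exists.\<close>

lemma compact_avg_G: "compact {t. \<exists>D. is_decomposition \<rho> D \<and> t = avg_G D}"
  for \<rho> :: "('d::finite \<times> 'd) op"
proof -
  let ?K = "convex hull ((\<lambda>\<phi>. (ket_bra \<phi>, G_pure \<phi>)) ` sphere (0 :: complex ^ ('d \<times> 'd)) 1)"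
  have "continuous_on A (ket_bra :: complex ^ ('d \<times> 'd) \<Rightarrow> _)" for A
    unfolding ket_bra_def by (intro continuous_intros)
  then have "compact ?K"
    by (intro compact_convex_hull compact_continuous_image continuous_on_Pair continuous_on_G_pure)
      auto
  then have "compact (snd ` (?K \<inter> ({\<rho>} \<times> UNIV)))"
    by (intro compact_continuous_image compact_Int_closed closed_Times continuous_intros) auto
  also have "snd ` (?K \<inter> ({\<rho>} \<times> UNIV)) = {t. (\<rho>, t) \<in> ?K}" by force
  also have "\<dots> = {t. \<exists>D. is_decomposition \<rho> D \<and> t = avg_G D}"
    unfolding decomposition_iff_convex_hull[symmetric] by auto
  finally show ?thesis .
qed

lemma G_conc_attained:
  assumes "mixture xs = \<rho>" "trace \<rho> = 1"
  obtains D where "is_decomposition \<rho> D" "G_conc \<rho> = avg_G D"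
    "\<And>D'. is_decomposition \<rho> D' \<Longrightarrow> avg_G D \<le> avg_G D'"
proof -
  obtain D0 where "is_decomposition \<rho> D0"
    using assms by (rule decomposition_of_mixture)
  then have "{t. \<exists>D. is_decomposition \<rho> D \<and> t = avg_G D} \<noteq> {}" by blast
  from compact_attains_inf[OF compact_avg_G this] obtain D
    where D: "is_decomposition \<rho> D" and min: "\<And>D'. is_decomposition \<rho> D' \<Longrightarrow> avg_G D \<le> avg_G D'"
    by blast
  have "G_conc \<rho> = avg_G D"
    unfolding G_conc_def using D min by (intro Least_equality) auto
  with D min show ?thesis by (intro that)
qed

text \<open>The convex-roof bound that undoes the refinement of outcomes at the end of a
  protocol.\<close>

lemma G_conc_le:
  assumes "mixture xs = \<rho>" "trace \<rho> = 1"
  shows "G_conc \<rho> \<le> (\<Sum>x\<leftarrow>xs. G_pure x)"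
  using assms by (metis G_conc_attained decomposition_of_mixture)

text \<open>A rank-one operator decomposes only into multiples of its own vector, so every
  decomposition has the same average.\<close>

lemma G_conc_ket_bra:
  fixes \<phi> :: "complex ^ ('d::finite \<times> 'd)"
  assumes "norm \<phi> = 1"
  shows "G_conc (ket_bra \<phi>) = G_pure \<phi>"
proof -
  have \<phi>: "cip \<phi> \<phi> = 1" by (simp add: cip_self assms)
  have "mixture [\<phi>] = ket_bra \<phi>" "trace (ket_bra \<phi>) = 1"
    by (simp_all add: trace_ket_bra assms)
  then obtain D where "is_decomposition (ket_bra \<phi>) D" and GD: "G_conc (ket_bra \<phi>) = avg_G D"
    by (rule G_conc_attained)
  then obtain xs where xs: "mixture xs = ket_bra \<phi>" and G: "(\<Sum>x\<leftarrow>xs. G_pure x) = avg_G D"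
    by (blast elim: mixture_of_decomposition)
  have "x = cip \<phi> x *s \<phi>" if x: "x \<in> set xs" for x
  proof -
    \<comment> \<open>The component of \<open>x\<close> orthogonal to \<open>\<phi>\<close> is
      killed by the operator, hence orthogonal to \<open>x\<close> as well, and so to
      itself.\<close>
    define z where "z = x - cip \<phi> x *s \<phi>"
    have z: "cip \<phi> z = 0" by (simp add: z_def cip_diff_right cip_scale_right \<phi>)
    then have "cip z (mixture xs *v z) = 0" by (simp add: xs ket_bra_vector)
    then have "cip x z = 0" using mixture_kernel x by blast
    then have "cip (x - cip \<phi> x *s \<phi>) z = 0" by (simp add: z cip_diff_left cip_scale_left)
    then show ?thesis unfolding z_def[symmetric] by (simp add: cip_self_eq_0 z_def)
  qed
  then have "G_pure x = (norm (cip x \<phi>))\<^sup>2 * G_pure \<phi>" if "x \<in> set xs" for x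
    using that G_pure_scale[of "cip \<phi> x" \<phi>] by (simp add: cip_commute[of x \<phi>])
  then have "(\<Sum>x\<leftarrow>xs. G_pure x) = (\<Sum>x\<leftarrow>xs. (norm (cip x \<phi>))\<^sup>2 * G_pure \<phi>)"
    by (intro arg_cong[of _ _ sum_list] map_cong) auto
  also have "\<dots> = (\<Sum>x\<leftarrow>xs. (norm (cip x \<phi>))\<^sup>2) * G_pure \<phi>"
    by (simp add: sum_list_mult_const)
  also have "(\<Sum>x\<leftarrow>xs. (norm (cip x \<phi>))\<^sup>2) = 1"
  proof -
    have "complex_of_real (\<Sum>x\<leftarrow>xs. (norm (cip x \<phi>))\<^sup>2) = of_real 1"
      unfolding cip_mixture[symmetric] xs by (simp add: ket_bra_vector \<phi>)
    then show ?thesis by (simp only: of_real_eq_iff)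
  qed
  finally show ?thesis using GD G by simp
qed

lemma trace_ptrace_S: "trace (ptrace_S \<rho>) = trace \<rho>"
  by (simp add: trace_def ptrace_S_def sum_UNIV_triple sum_UNIV_pair)

text \<open>Links the maximum over normalised decompositions to the supremum \<open>assist\<close>,
  and yields an optimal list for S to steer to.\<close>

lemma G_of_assistance_attained:
  fixes \<psi> :: "complex ^ ('d::finite \<times> 'd \<times> 'n::finite)"
  assumes "norm \<psi> = 1"
  obtains xs where "mixture xs = ptrace_S (ket_bra \<psi>)"
    "G_of_assistance \<psi> = (\<Sum>x\<leftarrow>xs. G_pure x)"
    "G_of_assistance \<psi> = assist (ptrace_S (ket_bra \<psi>))"
proof -
  let ?\<tau> = "ptrace_S (ket_bra \<psi>)"
  obtain ys where ys: "mixture ys = ?\<tau>" unfolding ptrace_ket_bra by (rule mixture_columns)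
  have tr: "trace ?\<tau> = 1" by (simp add: trace_ptrace_S trace_ket_bra assms)
  obtain D0 where "is_decomposition ?\<tau> D0"
    using ys tr by (rule decomposition_of_mixture)
  then have "{t. \<exists>D. is_decomposition ?\<tau> D \<and> t = avg_G D} \<noteq> {}" by blast
  from compact_attains_sup[OF compact_avg_G this] obtain D
    where D: "is_decomposition ?\<tau> D" and max: "\<And>D'. is_decomposition ?\<tau> D' \<Longrightarrow> avg_G D' \<le> avg_G D"
    by blast
  have G: "G_of_assistance \<psi> = avg_G D"
    unfolding G_of_assistance_def using D max by (intro Greatest_equality) auto
  obtain xs where xs: "mixture xs = ?\<tau>" "(\<Sum>x\<leftarrow>xs. G_pure x) = avg_G D"
    using D by (rule mixture_of_decomposition)
  have "assist ?\<tau> \<le> avg_G D"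
    using ys by (rule assist_least) (metis decomposition_of_mixture tr max)
  moreover have "avg_G D \<le> assist ?\<tau>" using assist_upper[OF xs(1)] xs(2) by simp
  ultimately show ?thesis using that xs G by simp
qed

section \<open>Protocols\<close>

text \<open>The refinement of an outcome to its individual Kraus operators, at the level of
  vectors.\<close>

lemma kraus_map_mixture:
  "kraus_map Ms (mixture \<Psi>) = mixture (concat (map (\<lambda>M. map ((*v) M) \<Psi>) Ms))"
  by (induction Ms) (simp_all add: kraus_map_def mixture_map_mult)

text \<open>The trace is a sum of squared norms, so the \<open>Re\<close> in
  \<open>outcome_prob\<close> discards nothing.\<close>

lemma outcome_prob_mixture:
  "complex_of_real (outcome_prob Ms (mixture \<Psi>)) = trace (kraus_map Ms (mixture \<Psi>))"
  unfolding outcome_prob_def kraus_map_mixture trace_mixture Re_complex_of_real ..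

lemma ptrace_S_add: "ptrace_S (\<rho> + \<sigma>) = ptrace_S \<rho> + ptrace_S \<sigma>"
  by (simp add: ptrace_S_def vec_eq_iff sum.distrib)

lemma ptrace_S_scaleR: "ptrace_S (c *\<^sub>R \<rho>) = c *\<^sub>R ptrace_S \<rho>"
  by (simp add: ptrace_S_def vec_eq_iff scaleR_sum_right)

text \<open>Joins decompositions of the individual reduced states; each contributes at most its
  \<open>assist\<close>. Used where a protocol stops.\<close>

lemma ptrace_S_mixture:
  obtains xs where "mixture xs = ptrace_S (mixture \<Psi>)"
    "(\<Sum>x\<leftarrow>xs. G_pure x) \<le> (\<Sum>\<psi>\<leftarrow>\<Psi>. assist (ptrace_S (ket_bra \<psi>)))"
proof (induction \<Psi> arbitrary: thesis)
  case Nil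
  show ?case by (rule Nil[of "[]"]) (simp_all add: ptrace_S_def vec_eq_iff)
next
  case (Cons \<psi> \<Psi>)
  obtain xs where xs: "mixture xs = ptrace_S (ket_bra \<psi>)"
    unfolding ptrace_ket_bra by (rule mixture_columns)
  obtain ys where "mixture ys = ptrace_S (mixture \<Psi>)"
    "(\<Sum>x\<leftarrow>ys. G_pure x) \<le> (\<Sum>\<psi>\<leftarrow>\<Psi>. assist (ptrace_S (ket_bra \<psi>)))"
    by (rule Cons.IH)
  with xs assist_upper[OF xs] show ?case
    by (intro Cons.prems[of "xs @ ys"]) (simp_all add: ptrace_S_add)
qed

definition avg_G_conc :: "(real \<times> ('d::finite \<times> 'd \<times> 'n::finite) op) list \<Rightarrow> real" where
  "avg_G_conc E = (\<Sum>(q, \<sigma>)\<leftarrow>E. q * G_conc (ptrace_S \<sigma>))"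

lemma avg_G_conc_round:
  "avg_G_conc (concat (map (\<lambda>k. map (\<lambda>(q, \<sigma>). (p k * q, \<sigma>)) (E k)) ks)) =
    (\<Sum>k\<leftarrow>ks. p k * avg_G_conc (E k))"
proof -
  have "(\<Sum>(q, \<sigma>)\<leftarrow>map (\<lambda>(q, \<sigma>). (c * q, \<sigma>)) E'. q * G_conc (ptrace_S \<sigma>))
      = c * (\<Sum>(q, \<sigma>)\<leftarrow>E'. q * G_conc (ptrace_S \<sigma>))"
    for c and E' :: "(real \<times> ('a \<times> 'a \<times> 'b) op) list"
    by (induction E') (auto simp: algebra_simps)
  then show ?thesis
    by (induction ks) (simp_all add: avg_G_conc_def)
qed

lemma sum_list_nth: "(\<Sum>k\<leftarrow>[0..<length F]. h (F ! k)) = (\<Sum>x\<leftarrow>F. h x)"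
  by (metis (no_types, lifting) map_map map_nth o_def map_eq_conv)

lemma sum_list_concat_map: "(\<Sum>x\<leftarrow>concat xss. f x) = (\<Sum>xs\<leftarrow>xss. \<Sum>x\<leftarrow>xs. f x)"
  by (induction xss) simp_all

lemma sum_list_commute:
  fixes f :: "'a \<Rightarrow> 'b \<Rightarrow> 'c::comm_monoid_add"
  shows "(\<Sum>x\<leftarrow>xs. \<Sum>y\<leftarrow>ys. f x y) = (\<Sum>y\<leftarrow>ys. \<Sum>x\<leftarrow>xs. f x y)"
  by (induction xs) (simp_all add: sum_list_addf)

text \<open>Although outcomes may be coarse-grained, the bound is stated for the vectors produced by the
  individual Kraus operators; convexity of \<open>G_conc\<close> enters only at the end of the protocol.\<close>

lemma avg_G_conc_le_assist:
  assumes "locc_ensemble \<rho> E" "mixture \<Psi> = \<rho>" "trace \<rho> = 1"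
  shows "avg_G_conc E \<le> (\<Sum>\<psi>\<leftarrow>\<Psi>. assist (ptrace_S (ket_bra \<psi>)))"
  using assms
proof (induction arbitrary: \<Psi> rule: locc_ensemble.induct)
  case (stop \<rho>)
  obtain xs where xs: "mixture xs = ptrace_S (mixture \<Psi>)"
    and le: "(\<Sum>x\<leftarrow>xs. G_pure x) \<le> (\<Sum>\<psi>\<leftarrow>\<Psi>. assist (ptrace_S (ket_bra \<psi>)))"
    by (rule ptrace_S_mixture)
  have "G_conc (ptrace_S \<rho>) \<le> (\<Sum>x\<leftarrow>xs. G_pure x)"
    using xs stop by (intro G_conc_le) (simp_all add: trace_ptrace_S)
  with le show ?case by (simp add: avg_G_conc_def)
next
  case (round F \<rho> E)
  define a where "a \<psi> = assist (ptrace_S (ket_bra \<psi>))" for \<psi> :: "complex ^ ('a \<times> 'a \<times> 'b)"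
  have a_nonneg: "a \<psi> \<ge> 0" for \<psi>
    using mixture_columns[of "amp \<psi>"] assist_nonneg unfolding a_def ptrace_ket_bra by metis
  \<comment> \<open>Trades the outcome probability against the renormalisation of the
    vectors.\<close>
  have a_scale: "c * a ((1 / sqrt c) *\<^sub>R \<psi>) \<le> a \<psi>" if "c > 0" for c \<psi>
  proof -
    obtain ys where ys: "mixture ys = ptrace_S (ket_bra ((1 / sqrt c) *\<^sub>R \<psi>))"
      unfolding ptrace_ket_bra by (rule mixture_columns)
    have "c *\<^sub>R ptrace_S (ket_bra ((1 / sqrt c) *\<^sub>R \<psi>)) = ptrace_S (ket_bra \<psi>)"
      using that by (simp add: ket_bra_scaleR ptrace_S_scaleR power_divide)
    with assist_scaleR[OF ys that] show ?thesis by (simp add: a_def)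
  qed
  let ?p = "\<lambda>k. outcome_prob (F ! k) \<rho>"
  define \<Phi> where "\<Phi> Ms = concat (map (\<lambda>M. map ((*v) M) \<Psi>) Ms)"
    for Ms :: "('a \<times> 'a \<times> 'b) op list"
  have step: "?p k * avg_G_conc (E k) \<le> (\<Sum>\<phi>\<leftarrow>\<Phi> (F ! k). a \<phi>)"
    if k: "k < length F" "?p k > 0" for k
  proof -
    let ?s = "1 / sqrt (?p k)"
    have kraus: "kraus_map (F ! k) \<rho> = mixture (\<Phi> (F ! k))"
      using kraus_map_mixture[of "F ! k" \<Psi>] round.prems(1) by (simp add: \<Phi>_def)
    have "mixture (map (\<lambda>\<phi>. ?s *\<^sub>R \<phi>) xs) = (1 / ?p k) *\<^sub>R mixture xs" for xs
      using k(2) by (induction xs) (simp_all add: ket_bra_scaleR scaleR_add_right power_divide)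
    \<comment> \<open>The rescaled vectors decompose the normalised post-measurement state, so the
      induction hypothesis applies to them.\<close>
    then have mix: "mixture (map (\<lambda>\<phi>. ?s *\<^sub>R \<phi>) (\<Phi> (F ! k))) = post_state (F ! k) \<rho>"
      by (simp add: post_state_def kraus)
    have "trace (post_state (F ! k) \<rho>) = (1 / ?p k) *\<^sub>R complex_of_real (?p k)"
      using outcome_prob_mixture[of "F ! k" \<Psi>] round.prems(1)
      by (simp only: post_state_def trace_scaleR)
    also have "\<dots> = 1" using k(2) by (simp add: scaleR_conv_of_real)
    finally have tr: "trace (post_state (F ! k) \<rho>) = 1" .
    have "avg_G_conc (E k) \<le> (\<Sum>\<phi>\<leftarrow>\<Phi> (F ! k). a (?s *\<^sub>R \<phi>))"
      using round.IH[OF k mix tr] by (simp add: a_def o_def)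
    then have "?p k * avg_G_conc (E k) \<le> ?p k * (\<Sum>\<phi>\<leftarrow>\<Phi> (F ! k). a (?s *\<^sub>R \<phi>))"
      using k(2) by simp
    also have "\<dots> = (\<Sum>\<phi>\<leftarrow>\<Phi> (F ! k). ?p k * a (?s *\<^sub>R \<phi>))"
      by (simp add: sum_list_const_mult)
    also have "\<dots> \<le> (\<Sum>\<phi>\<leftarrow>\<Phi> (F ! k). a \<phi>)"
      using k(2) by (intro sum_list_mono a_scale)
    finally show ?thesis .
  qed
  \<comment> \<open>Dropped outcomes are put back as zeros, which nonnegativity of \<open>a\<close>
    bounds. The sum then runs over all Kraus operators and completeness can be used.\<close>
  have "(\<Sum>k\<leftarrow>filter (\<lambda>k. ?p k > 0) [0..<length F]. ?p k * avg_G_conc (E k))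
      = (\<Sum>k\<leftarrow>[0..<length F]. if ?p k > 0 then ?p k * avg_G_conc (E k) else 0)"
    by (rule sum_list_map_filter')
  also have "\<dots> \<le> (\<Sum>k\<leftarrow>[0..<length F]. \<Sum>\<phi>\<leftarrow>\<Phi> (F ! k). a \<phi>)"
    by (intro sum_list_mono) (auto intro!: step sum_list_nonneg a_nonneg)
  also have "\<dots> = (\<Sum>Ms\<leftarrow>F. \<Sum>\<phi>\<leftarrow>\<Phi> Ms. a \<phi>)"
    by (rule sum_list_nth)
  also have "\<dots> = (\<Sum>M\<leftarrow>concat F. \<Sum>\<psi>\<leftarrow>\<Psi>. a (M *v \<psi>))"
    by (simp add: sum_list_concat_map \<Phi>_def o_def)
  also have "\<dots> = (\<Sum>\<psi>\<leftarrow>\<Psi>. \<Sum>M\<leftarrow>concat F. a (M *v \<psi>))"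
    by (rule sum_list_commute)
  also have "\<dots> \<le> (\<Sum>\<psi>\<leftarrow>\<Psi>. a \<psi>)"
    unfolding a_def by (intro sum_list_mono assist_local_operation round.hyps)
  finally show ?case unfolding avg_G_conc_round a_def .
qed

text \<open>\<open>S\<close> steers to any decomposition of the reduced state. The operators taken from
  \<open>mixture_freedom\<close> form a complete measurement only with the projection onto the kernel of the
  amplitude matrix, an outcome of probability zero.\<close>

lemma steering:
  fixes \<psi> :: "complex ^ ('d::finite \<times> 'd \<times> 'n::finite)"
  assumes xs: "mixture xs = ptrace_S (ket_bra \<psi>)"
  obtains E where "locc_ensemble (ket_bra \<psi>) E" "avg_G_conc E = (\<Sum>x\<leftarrow>xs. G_pure x)"
proof -
  obtain m P where m: "\<And>x. x \<in> set xs \<Longrightarrow> amp \<psi> *v m x = x"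
    and mP: "mixture (map m xs) + P = mat 1" and YP: "amp \<psi> ** P = 0"
    and P: "adj P = P" "P ** P = P"
    using xs unfolding ptrace_ket_bra by (rule mixture_freedom) blast
  \<comment> \<open>The only nonzero row of \<open>K x\<close> is \<open>m x\<close>: on outcome
    \<open>x\<close>, S ends in a fixed basis state and A, B are left with
    \<open>amp \<psi> *v m x = x\<close>.\<close>
  define K where "K x = ((\<chi> i j. if i = undefined then m x $ j else 0) :: 'n op)" for x
  \<comment> \<open>The completeness relation of these operators is the transpose of
    \<open>mP\<close>, hence the transposed \<open>P\<close>.\<close>
  define Ms where "Ms = map (\<lambda>x. [K x]) xs @ [[transpose P]]"
  have K: "adj (K x) ** K x = transpose (ket_bra (m x))" for x
    by (simp add: K_def adj_def ket_bra_def transpose_def matrix_matrix_mult_def vec_eq_iff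
        mult_if_0 mult.commute cong: if_cong)
  have "adj (transpose P) ** transpose P = transpose (P ** adj P)"
    by (simp add: matrix_transpose_mul) (simp add: adj_def transpose_def)
  then have adjP: "adj (transpose P) ** transpose P = transpose P" by (simp add: P)
  have tr_add: "transpose (A + B) = transpose A + transpose B" for A B :: "'n op"
    by (simp add: transpose_def vec_eq_iff)
  have "(\<Sum>x\<leftarrow>xs. adj (K x) ** K x) = transpose (mixture (map m xs))"
    unfolding K by (induction xs) (simp_all add: tr_add, simp add: transpose_def vec_eq_iff)
  then have "kraus_complete Ms"
    unfolding kraus_complete_def Ms_def
    by (simp add: o_def adjP tr_add[symmetric] mP)
  define F where "F = map (map (on_S :: 'n op \<Rightarrow> ('d \<times> 'd \<times> 'n) op)) Ms"
  have F: "local_operation F"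
    using \<open>kraus_complete Ms\<close> unfolding local_operation_def F_def by blast
  \<comment> \<open>The protocol stops after this single measurement.\<close>
  define E where "E k = [(1::real, post_state (F ! k) (ket_bra \<psi>))]" for k
  let ?p = "\<lambda>k. outcome_prob (F ! k) (ket_bra \<psi>)"
  define R where "R = concat (map (\<lambda>k. map (\<lambda>(q, \<sigma>). (?p k * q, \<sigma>)) (E k))
    (filter (\<lambda>k. ?p k > 0) [0..<length F]))"
  have "locc_ensemble (ket_bra \<psi>) R"
    unfolding R_def by (rule locc_ensemble.round[OF F]) (simp add: E_def locc_ensemble.stop)
  define h where "h Ns = (if outcome_prob Ns (ket_bra \<psi>) > 0
    then outcome_prob Ns (ket_bra \<psi>) * G_conc (ptrace_S (post_state Ns (ket_bra \<psi>))) else 0)" for Ns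
  have "avg_G_conc (E k) = G_conc (ptrace_S (post_state (F ! k) (ket_bra \<psi>)))" for k
    by (simp add: avg_G_conc_def E_def)
  then have "avg_G_conc R = (\<Sum>k\<leftarrow>[0..<length F]. h (F ! k))"
    unfolding R_def avg_G_conc_round sum_list_map_filter' h_def by (simp only:)
  also have "\<dots> = (\<Sum>Ns\<leftarrow>F. h Ns)" by (rule sum_list_nth)
  also have "\<dots> = (\<Sum>x\<leftarrow>xs. h [on_S (K x)]) + h [on_S (transpose P)]"
    by (simp add: F_def Ms_def o_def)
  also have "h [on_S (transpose P)] = 0"
  proof -
    have "trace (ptrace_S (ket_bra (on_S (transpose P) *v \<psi>))) = 0"
      by (simp add: ptrace_ket_bra amp_on_S YP) (simp add: trace_def)
    then show ?thesis
      by (simp add: h_def outcome_prob_def kraus_map_def ket_bra_mult[symmetric] trace_ptrace_S)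
  qed
  also have "(\<Sum>x\<leftarrow>xs. h [on_S (K x)]) = (\<Sum>x\<leftarrow>xs. G_pure x)"
  proof (intro arg_cong[of _ _ sum_list] map_cong refl)
    fix x assume x: "x \<in> set xs"
    have "amp (on_S (K x) *v \<psi>) $ a $ s = (if s = undefined then x $ a else 0)" for a s
      unfolding amp_on_S using arg_cong[OF m[OF x], of "\<lambda>v. v $ a"]
      by (simp add: K_def matrix_matrix_mult_def matrix_vector_mult_def transpose_def)
    then have pt: "ptrace_S (ket_bra (on_S (K x) *v \<psi>)) = ket_bra x"
      unfolding ptrace_ket_bra
      by (simp add: matrix_matrix_mult_def adj_def ket_bra_def vec_eq_iff
          mult_if_0 cong: if_cong)
    then have prob: "outcome_prob [on_S (K x)] (ket_bra \<psi>) = (norm x)\<^sup>2"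
      using trace_ket_bra[of x]
      by (simp add: outcome_prob_def kraus_map_def ket_bra_mult[symmetric] trace_ptrace_S[symmetric])
    have post: "ptrace_S (post_state [on_S (K x)] (ket_bra \<psi>)) = ket_bra ((1 / norm x) *\<^sub>R x)"
      by (simp add: post_state_def prob kraus_map_def ket_bra_mult[symmetric] ptrace_S_scaleR pt
          ket_bra_scaleR power_divide)
    show "h [on_S (K x)] = G_pure x"
    proof (cases "x = 0")
      \<comment> \<open>A zero vector is an outcome of probability zero, which the protocol drops;
        its \<open>G_pure\<close> vanishes too.\<close>
      case True
      then show ?thesis using G_pure_scale[of 0 x] prob by (simp add: h_def)
    next
      case False
      then show ?thesis
        by (simp add: h_def prob post G_conc_ket_bra) (simp add: G_pure_scaleR power_divide)
    qed
  qed
  finally have "avg_G_conc R = (\<Sum>x\<leftarrow>xs. G_pure x)" by simp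
  with \<open>locc_ensemble (ket_bra \<psi>) R\<close> show ?thesis by (rule that)
qed

theorem mainTheorem2:
  fixes \<psi> :: "complex ^ ('d::finite \<times> 'd \<times> 'n::finite)"
  assumes "CARD('d) \<ge> 2"
    and "norm \<psi> = 1"
  shows "assisted_G (ket_bra \<psi>) = G_of_assistance \<psi>"
proof -
  obtain xs where xs: "mixture xs = ptrace_S (ket_bra \<psi>)"
    and sum: "G_of_assistance \<psi> = (\<Sum>x\<leftarrow>xs. G_pure x)"
    and assist: "G_of_assistance \<psi> = assist (ptrace_S (ket_bra \<psi>))"
    using assms(2) by (rule G_of_assistance_attained)
  \<comment> \<open>Steering to the optimal decomposition attains the upper bound proved next, so
    the supremum is a maximum.\<close>
  obtain E where E: "locc_ensemble (ket_bra \<psi>) E" "avg_G_conc E = (\<Sum>x\<leftarrow>xs. G_pure x)"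
    using xs by (rule steering)
  have "avg_G_conc E' \<le> G_of_assistance \<psi>" if "locc_ensemble (ket_bra \<psi>) E'" for E'
    using avg_G_conc_le_assist[OF that, of "[\<psi>]"] assms(2) by (simp add: trace_ket_bra assist)
  then show ?thesis
    unfolding assisted_G_def avg_G_conc_def[symmetric]
    using E sum by (intro cSup_eq_maximum) (auto intro!: exI[of _ E])
qed

end
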